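(* Let $\mathbf b=(b_1,\dots,b_{n-2})\in\mathbb C^{n-2}$, $n\ge 2$, and let $sl_n^{(\mathbf b)}\subset sl_n(\mathbb C)$ be the Lie subalgebra generated by $u_i=e_i+b_{i-1}f_{i-1}$, $1\le i\le n-1$ (with $b_0=0$, $f_0=0$). Then $sl_n^{(\mathbf b)}$ preserves the form $$\omega_{\mathbf b}:=\sum_{k=1}^{n-1}\Big(\prod_{i=k}^{n-2}(-b_i)\Big)\,v_k^*\wedge v_{k+1}^*$$ in $\mathbb C^n=\mathbb C v_1\oplus\cdots\oplus\mathbb C v_n$. If $n$ is even, then this form is non-degenerate. In this case $sl_n^{(\mathbf b)}$ is the intersection of $sp_{\omega_{\mathbf b}}\subset sl_n$ with the annihilator of $$v^1=v_1-b_1v_3+b_1b_3v_5-b_1b_3b_5v_7+\cdots\in\mathbb C^n;$$ therefore, $sl_n^{(\mathbf b)}$ is isomorphic to $sp_{n-1}$ when $b_1\cdots b_{n-2}\neq0$. If $n$ is odd, then the form $\omega_{\mathbf b}$ has a one-dimensional kernel that is an invariant of the action of $sl_n^{(\mathbf b)}$.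
   Context: $e_i=E_{i,i+1}$, $f_i=E_{i+1,i}$ are the standard Chevalley generators of $sl_n$; $v_1,\dots,v_n$ is the standard basis of $\mathbb C^n$ (the standard $sl_n$-module) and $v_1^*,\dots,v_n^*$ is the dual basis. "Preserves $\omega$" is meant infinitesimally: $\omega(xv,w)+\omega(v,xw)=0$. $sp_\omega$ is the Lie algebra of all $x\in sl_n$ preserving $\omega$. The annihilator of $v\in\mathbb C^n$ is $\{x: xv=0\}$. For $n$ even, $sp_{n-1}$ is the odd symplectic Lie algebra (Gelfand–Zelevinsky), i.e. the annihilator in $sp_n$ of a nonzero vector of $\mathbb C^n$. In $v^1$ only basis vectors $v_j$ with $j\le n$ odd occur. Empty products equal $1$.
   Formalization: For n even, non-degeneracy is stated when b_1⋯b_{n-2}≠0 (it fails for n=4, b=0) and the intersection formula when ω_b is non-degenerate; for n odd, the one-dimensional kernel claim is stated when b_2⋯b_{n-2}≠0 (it fails for n=5, b=0). *)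

theory Defs
  imports "Jordan_Normal_Form.VS_Connect"
begin

text \<open>
  Matrices and vectors of the library are indexed from 0. All indices below
  (of \<open>E\<close>, \<open>e\<close>, \<open>f\<close>, \<open>u\<close>, \<open>b\<close>, and of the basis vectors) run from 1; the shift is made once,
  in \<open>elem_mat\<close>, \<open>basis_vec\<close> and \<open>dual_basis\<close>. The tuple \<open>(b\<^sub>1,\<dots>,b\<^sub>n\<^sub>-\<^sub>2)\<close> is given
  by a function \<open>b\<close> on the natural numbers, of which only the values at \<open>1,\<dots>,n-2\<close> are used.
\<close>

subsection \<open>The Lie algebra $sl_n$ and its subalgebras\<close>

definition lie_bracket :: "complex mat \<Rightarrow> complex mat \<Rightarrow> complex mat" where
  "lie_bracket x y = x * y - y * x"

definition mat_trace :: "complex mat \<Rightarrow> complex" where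
  "mat_trace x = (\<Sum>i<dim_row x. x $$ (i, i))"

definition sl :: "nat \<Rightarrow> complex mat set" where
  "sl n = {x \<in> carrier_mat n n. mat_trace x = 0}"

definition lie_subalgebra :: "nat \<Rightarrow> complex mat set \<Rightarrow> bool" where
  "lie_subalgebra n L \<longleftrightarrow>
     L \<subseteq> sl n \<and> 0\<^sub>m n n \<in> L \<and>
     (\<forall>x\<in>L. \<forall>y\<in>L. x + y \<in> L \<and> lie_bracket x y \<in> L) \<and>
     (\<forall>c. \<forall>x\<in>L. c \<cdot>\<^sub>m x \<in> L)"

definition lie_isomorphic :: "complex mat set \<Rightarrow> complex mat set \<Rightarrow> bool" where
  "lie_isomorphic L L' \<longleftrightarrow>
     (\<exists>\<phi>. bij_betw \<phi> L L' \<and>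
          (\<forall>x\<in>L. \<forall>y\<in>L. \<phi> (x + y) = \<phi> x + \<phi> y) \<and>
          (\<forall>c. \<forall>x\<in>L. \<phi> (c \<cdot>\<^sub>m x) = c \<cdot>\<^sub>m \<phi> x) \<and>
          (\<forall>x\<in>L. \<forall>y\<in>L. \<phi> (lie_bracket x y) = lie_bracket (\<phi> x) (\<phi> y)))"

definition elem_mat :: "nat \<Rightarrow> nat \<Rightarrow> nat \<Rightarrow> complex mat" where
  "elem_mat n i j = mat n n (\<lambda>(r, c). if r + 1 = i \<and> c + 1 = j then 1 else 0)"

definition chev_e :: "nat \<Rightarrow> nat \<Rightarrow> complex mat" where
  "chev_e n i = elem_mat n i (i + 1)"

definition chev_f :: "nat \<Rightarrow> nat \<Rightarrow> complex mat" where
  "chev_f n i = elem_mat n (i + 1) i"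

text \<open>The case distinction implements the convention \<open>b\<^sub>0 = 0\<close>, \<open>f\<^sub>0 = 0\<close>.\<close>

definition u_gen :: "nat \<Rightarrow> (nat \<Rightarrow> complex) \<Rightarrow> nat \<Rightarrow> complex mat" where
  "u_gen n b i =
     chev_e n i + (if i = 1 then 0\<^sub>m n n else b (i - 1) \<cdot>\<^sub>m chev_f n (i - 1))"

definition sl_b :: "nat \<Rightarrow> (nat \<Rightarrow> complex) \<Rightarrow> complex mat set" where
  "sl_b n b = lie_subalgebra n hull (u_gen n b ` {1..n - 1})"

subsection \<open>Skew-symmetric forms\<close>

type_synonym form = "complex vec \<Rightarrow> complex vec \<Rightarrow> complex"

definition basis_vec :: "nat \<Rightarrow> nat \<Rightarrow> complex vec" where
  "basis_vec n j = unit_vec n (j - 1)"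

definition dual_basis :: "nat \<Rightarrow> complex vec \<Rightarrow> complex" where
  "dual_basis j v = v $ (j - 1)"

definition wedge :: "(complex vec \<Rightarrow> complex) \<Rightarrow> (complex vec \<Rightarrow> complex) \<Rightarrow> form" where
  "wedge \<alpha> \<beta> v w = \<alpha> v * \<beta> w - \<alpha> w * \<beta> v"

definition omega_b :: "nat \<Rightarrow> (nat \<Rightarrow> complex) \<Rightarrow> form" where
  "omega_b n b v w =
     (\<Sum>k = 1..n - 1. (\<Prod>i = k..n - 2. - b i) * wedge (dual_basis k) (dual_basis (k + 1)) v w)"

definition preserves :: "nat \<Rightarrow> complex mat \<Rightarrow> form \<Rightarrow> bool" where
  "preserves n x \<omega> \<longleftrightarrow>
     (\<forall>v\<in>carrier_vec n. \<forall>w\<in>carrier_vec n. \<omega> (x *\<^sub>v v) w + \<omega> v (x *\<^sub>v w) = 0)"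

definition form_kernel :: "nat \<Rightarrow> form \<Rightarrow> complex vec set" where
  "form_kernel n \<omega> = {v \<in> carrier_vec n. \<forall>w\<in>carrier_vec n. \<omega> v w = 0}"

definition nondegenerate :: "nat \<Rightarrow> form \<Rightarrow> bool" where
  "nondegenerate n \<omega> \<longleftrightarrow> form_kernel n \<omega> = {0\<^sub>v n}"

abbreviation subspace_dim :: "nat \<Rightarrow> complex vec set \<Rightarrow> nat" where
  "subspace_dim n W \<equiv>
     vectorspace.dim class_ring (module_vec TYPE(complex) n\<lparr>carrier := W\<rparr>)"

subsection \<open>Symplectic and odd symplectic Lie algebras\<close>

definition sp_form :: "nat \<Rightarrow> form \<Rightarrow> complex mat set" where
  "sp_form n \<omega> = {x \<in> sl n. preserves n x \<omega>}"

definition annihilator :: "nat \<Rightarrow> complex vec \<Rightarrow> complex mat set" where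
  "annihilator n v = {x \<in> carrier_mat n n. x *\<^sub>v v = 0\<^sub>v n}"

definition std_symplectic :: "nat \<Rightarrow> form" where
  "std_symplectic n v w =
     (\<Sum>k = 1..n div 2. wedge (dual_basis k) (dual_basis (n div 2 + k)) v w)"

text \<open>
  For even \<open>n\<close> and \<open>w \<noteq> 0\<close>, this is a model of the odd symplectic Lie algebra $sp_{n-1}$
  (Gelfand--Zelevinsky). Up to isomorphism it does not depend on \<open>w\<close>.
\<close>

definition odd_sp :: "nat \<Rightarrow> complex vec \<Rightarrow> complex mat set" where
  "odd_sp n w = sp_form n (std_symplectic n) \<inter> annihilator n w"

text \<open>
  The vector \<open>v\<^sup>1 = v\<^sub>1 - b\<^sub>1 v\<^sub>3 + b\<^sub>1 b\<^sub>3 v\<^sub>5 - \<dots>\<close>: the coefficient of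
  \<open>v\<^bsub>2m+1\<^esub>\<close> is $(-1)^m b_1 b_3 \cdots b_{2m-1}$. The terms with \<open>2m+1 \<le> n\<close> are those with
  \<open>m < (n+1) div 2\<close>.
\<close>

definition v_one :: "nat \<Rightarrow> (nat \<Rightarrow> complex) \<Rightarrow> complex vec" where
  "v_one n b =
     finsum_vec TYPE(complex) n
       (\<lambda>m. ((-1) ^ m * (\<Prod>l = 1..m. b (2 * l - 1))) \<cdot>\<^sub>v basis_vec n (2 * m + 1))
       {..<(n + 1) div 2}"

subsection \<open>The generated subalgebra is a subalgebra\<close>

lemma mat_trace_comm:
  assumes "x \<in> carrier_mat n n" "y \<in> carrier_mat n n"
  shows "mat_trace (x * y) = mat_trace (y * x)"
proof -
  have "mat_trace (x * y) = (\<Sum>i<n. \<Sum>k<n. x $$ (i, k) * y $$ (k, i))"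
    using assms by (auto simp: mat_trace_def scalar_prod_def lessThan_atLeast0 intro!: sum.cong)
  also have "\<dots> = (\<Sum>k<n. \<Sum>i<n. x $$ (i, k) * y $$ (k, i))"
    by (rule sum.swap)
  also have "\<dots> = mat_trace (y * x)"
    using assms
    by (auto simp: mat_trace_def scalar_prod_def lessThan_atLeast0 mult.commute intro!: sum.cong)
  finally show ?thesis .
qed

lemma lie_subalgebra_sl: "lie_subalgebra n (sl n)"
proof -
  have "lie_bracket x y \<in> sl n" if "x \<in> sl n" "y \<in> sl n" for x y
  proof -
    have c: "x \<in> carrier_mat n n" "y \<in> carrier_mat n n" using that by (auto simp: sl_def)
    have "mat_trace (x * y - y * x) = mat_trace (x * y) - mat_trace (y * x)"
      using c by (auto simp: mat_trace_def sum_subtractf)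
    then show ?thesis
      using c mat_trace_comm[OF c] by (auto simp: sl_def lie_bracket_def)
  qed
  then show ?thesis
    by (auto simp: lie_subalgebra_def sl_def mat_trace_def sum.distrib
        simp flip: sum_distrib_left)
qed

lemma u_gen_in_sl:
  assumes "i \<in> {1..n - 1}"
  shows "u_gen n b i \<in> sl n"
  using assms
  by (auto simp: u_gen_def chev_e_def chev_f_def elem_mat_def sl_def mat_trace_def
      intro!: sum.neutral)

lemma lie_subalgebra_sl_b: "lie_subalgebra n (sl_b n b)"
proof -
  have "u_gen n b ` {1..n - 1} \<subseteq> sl n"
    using u_gen_in_sl by blast
  then have "sl_b n b \<subseteq> sl n"
    unfolding sl_b_def by (rule hull_minimal) (rule lie_subalgebra_sl)
  then show ?thesis
    unfolding sl_b_def hull_def lie_subalgebra_def by auto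
qed

end

theory Submission
  imports Defs "Jordan_Normal_Form.DL_Rank"
begin

text \<open>
  Let \<open>J\<close> be the Gram matrix of \<open>\<omega>\<^sub>b\<close>. The generator \<open>u\<^sub>i\<close> is a multiple of the transvection
  \<open>v \<mapsto> \<omega>\<^sub>b(e\<^sub>i, v) e\<^sub>i\<close>, so it preserves \<open>\<omega>\<^sub>b\<close>, and \<open>v\<^sup>1\<close> is orthogonal to \<open>e\<^sub>1,\<dots>,e\<^sub>n\<^sub>-\<^sub>1\<close>.
  If \<open>\<omega>\<^sub>b\<close> is nondegenerate, then the elements of the symplectic Lie algebra are the matrices \<open>A J\<close>
  with \<open>A\<close> symmetric, and such a matrix kills \<open>v\<^sup>1\<close> iff the last row and column of \<open>A\<close> vanish. These
  are spanned by the \<open>(E\<^sub>i\<^sub>j + E\<^sub>j\<^sub>i) J\<close> with \<open>i, j < n\<close>, which arise from the transvections by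
  bracketing the one for \<open>i, j\<close> with the \<open>(j+1)\<close>-st generator.

  For the isomorphism with the odd symplectic algebra, \<open>\<omega>\<^sub>b\<close> is carried to the standard form by
  an explicit matrix, and \<open>v\<^sup>1\<close> to the prescribed vector by at most two transvections.
\<close>

subsection \<open>The form and its Gram matrix\<close>

definition omega_coeff :: "nat \<Rightarrow> (nat \<Rightarrow> complex) \<Rightarrow> nat \<Rightarrow> complex" where
  "omega_coeff n b k = (\<Prod>i = k..n - 2. - b i)"

text \<open>Write c_k for \<open>omega_coeff n b k\<close>. This recursion ties the coefficients of
  the form to the parameters \<open>b i\<close> of the generators.\<close>

lemma omega_coeff_step:
  assumes "k < n - 1"
  shows "omega_coeff n b k = - b k * omega_coeff n b (Suc k)"
  using assms by (simp add: omega_coeff_def prod.atLeast_Suc_atMost)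

lemma omega_coeff_nonzero:
  assumes "(\<Prod>i = l..n - 2. b i) \<noteq> 0" "l \<le> k"
  shows "omega_coeff n b k \<noteq> 0"
  using assms by (auto simp: omega_coeff_def)

text \<open>The argument of \<open>omega_coeff\<close> and that of \<open>u_gen\<close> count from 1; the matrix and vector indices
  used from here on count from 0.\<close>

definition gram :: "nat \<Rightarrow> (nat \<Rightarrow> complex) \<Rightarrow> complex mat" where
  "gram n b = mat n n (\<lambda>(r, c).
     if c = Suc r then omega_coeff n b c else if r = Suc c then - omega_coeff n b r else 0)"

lemma gram_carrier [simp]: "gram n b \<in> carrier_mat n n"
  and gram_dim [simp]: "dim_row (gram n b) = n" "dim_col (gram n b) = n"
  by (auto simp: gram_def)

lemma gram_mult_zero [simp]: "gram n b *\<^sub>v 0\<^sub>v n = 0\<^sub>v n"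
  by (intro eq_vecI) auto

lemma gram_skew: "i < n \<Longrightarrow> j < n \<Longrightarrow> gram n b $$ (i, j) = - gram n b $$ (j, i)"
  by (auto simp: gram_def)

lemma transpose_gram: "(gram n b)\<^sup>T = - gram n b"
  by (rule eq_matI) (auto simp: gram_def)

lemma gram_mult_vec:
  assumes "w \<in> carrier_vec n" "r < n"
  shows "(gram n b *\<^sub>v w) $ r =
     (if Suc r < n then omega_coeff n b (Suc r) * w $ Suc r else 0) -
     (if r = 0 then 0 else omega_coeff n b r * w $ (r - 1))"
proof -
  \<comment> \<open>A row has at most two nonzero entries. At \<open>r = 0\<close> the truncated
    \<open>r - 1\<close> is 0, so the guard on \<open>r = 0\<close> has to suppress the second
    delta.\<close>
  have "(gram n b *\<^sub>v w) $ r =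
    (\<Sum>c<n. (if c = Suc r then omega_coeff n b (Suc r) * w $ c else 0) -
            (if c = r - 1 then if r = 0 then 0 else omega_coeff n b r * w $ c else 0))"
    using assms by (auto simp: gram_def scalar_prod_def lessThan_atLeast0 intro!: sum.cong)
  also have "\<dots> = (if Suc r < n then omega_coeff n b (Suc r) * w $ Suc r else 0) -
     (if r = 0 then 0 else omega_coeff n b r * w $ (r - 1))"
    using assms by (simp add: sum_subtractf sum.delta)
  finally show ?thesis .
qed

lemma omega_b_sum:
  "omega_b n b v w =
     (\<Sum>k<n - 1. omega_coeff n b (Suc k) * (v $ k * w $ Suc k - w $ k * v $ Suc k))"
proof -
  have "omega_b n b v w = (\<Sum>k\<in>Suc ` {..<n - 1}.
      omega_coeff n b k * wedge (dual_basis k) (dual_basis (k + 1)) v w)"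
    unfolding omega_b_def omega_coeff_def
    by (rule sum.cong) (auto simp: image_Suc_lessThan)
  also have "\<dots> = (\<Sum>k<n - 1. omega_coeff n b (Suc k) * (v $ k * w $ Suc k - w $ k * v $ Suc k))"
    by (subst sum.reindex) (auto simp: wedge_def dual_basis_def)
  finally show ?thesis .
qed

lemma omega_b_gram:
  assumes v: "v \<in> carrier_vec n" and w: "w \<in> carrier_vec n"
  shows "omega_b n b v w = v \<bullet> (gram n b *\<^sub>v w)"
proof (cases n)
  case 0
  with v w show ?thesis by (simp add: omega_b_sum scalar_prod_def)
next
  case (Suc m)
  let ?c = "omega_coeff n b"
  have "v \<bullet> (gram n b *\<^sub>v w) = (\<Sum>r<Suc m. v $ r * (gram n b *\<^sub>v w) $ r)"
    using w Suc by (simp add: scalar_prod_def lessThan_atLeast0)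
  also have "\<dots> = (\<Sum>r<Suc m. v $ r * (if r < m then ?c (Suc r) * w $ Suc r else 0)) -
      (\<Sum>r<Suc m. v $ r * (if r = 0 then 0 else ?c r * w $ (r - 1)))"
    using gram_mult_vec[OF w] Suc
    by (simp add: right_diff_distrib sum_subtractf del: sum.lessThan_Suc)
  also have "(\<Sum>r<Suc m. v $ r * (if r < m then ?c (Suc r) * w $ Suc r else 0)) =
      (\<Sum>r<m. v $ r * (?c (Suc r) * w $ Suc r))"
    by simp
  also have "(\<Sum>r<Suc m. v $ r * (if r = 0 then 0 else ?c r * w $ (r - 1))) =
      (\<Sum>r<m. v $ Suc r * (?c (Suc r) * w $ r))"
    by (subst sum.lessThan_Suc_shift) simp
  finally show ?thesis
    using Suc by (simp add: omega_b_sum sum_subtractf algebra_simps)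
qed

lemma omega_b_add_left:
  assumes "u \<in> carrier_vec n" "v \<in> carrier_vec n" "w \<in> carrier_vec n"
  shows "omega_b n b (u + v) w = omega_b n b u w + omega_b n b v w"
  using assms by (simp add: omega_b_gram add_scalar_prod_distrib[of _ n] mult_mat_vec_carrier[of _ n n])

lemma omega_b_smult_left:
  assumes "v \<in> carrier_vec n" "w \<in> carrier_vec n"
  shows "omega_b n b (a \<cdot>\<^sub>v v) w = a * omega_b n b v w"
  using assms by (simp add: omega_b_gram)

lemma omega_b_swap: "omega_b n b v w = - omega_b n b w v"
  by (simp add: omega_b_sum algebra_simps flip: sum_negf)

lemma omega_b_add_right:
  assumes "u \<in> carrier_vec n" "v \<in> carrier_vec n" "w \<in> carrier_vec n"
  shows "omega_b n b w (u + v) = omega_b n b w u + omega_b n b w v"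
  using omega_b_add_left[OF assms] by (simp add: omega_b_swap[of n b w])

lemma omega_b_smult_right:
  assumes "v \<in> carrier_vec n" "w \<in> carrier_vec n"
  shows "omega_b n b w (a \<cdot>\<^sub>v v) = a * omega_b n b w v"
  using omega_b_smult_left[OF assms] by (simp add: omega_b_swap[of n b w])

lemma omega_b_unit_left:
  assumes "i < n" "w \<in> carrier_vec n"
  shows "omega_b n b (unit_vec n i) w = (gram n b *\<^sub>v w) $ i"
  using assms by (simp add: omega_b_gram mult_mat_vec_carrier[of _ n n] del: index_mult_mat_vec)

lemma form_kernel_omega_b:
  "form_kernel n (omega_b n b) = {v \<in> carrier_vec n. gram n b *\<^sub>v v = 0\<^sub>v n}"
proof -
  have "(\<forall>w\<in>carrier_vec n. omega_b n b v w = 0) \<longleftrightarrow> gram n b *\<^sub>v v = 0\<^sub>v n"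
    if v: "v \<in> carrier_vec n" for v
  proof
    assume *: "\<forall>w\<in>carrier_vec n. omega_b n b v w = 0"
    show "gram n b *\<^sub>v v = 0\<^sub>v n"
    proof (rule eq_vecI)
      fix i assume "i < dim_vec (0\<^sub>v n :: complex vec)"
      then show "(gram n b *\<^sub>v v) $ i = 0\<^sub>v n $ i"
        using * v omega_b_unit_left[of i n v b] omega_b_swap[of n b "unit_vec n i" v] by simp
    qed simp
  next
    assume "gram n b *\<^sub>v v = 0\<^sub>v n"
    then show "\<forall>w\<in>carrier_vec n. omega_b n b v w = 0"
      using v by (auto simp: omega_b_swap[of n b v] omega_b_gram)
  qed
  then show ?thesis by (auto simp: form_kernel_def)
qed

subsection \<open>The generators\<close>

text \<open>For \<open>i < n - 1\<close>, row \<open>i\<close> (counted from 0) is the only nonzero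
  row of \<open>u_gen n b (Suc i)\<close>. This is that row as a functional, so the generator has
  rank one.\<close>

definition u_functional :: "(nat \<Rightarrow> complex) \<Rightarrow> nat \<Rightarrow> complex vec \<Rightarrow> complex" where
  "u_functional b i v = v $ Suc i + (if i = 0 then 0 else b i * v $ (i - 1))"

lemma u_gen_index:
  assumes "r < n" "c < n"
  shows "u_gen n b (Suc i) $$ (r, c) =
     (if r = i then if c = Suc i then 1 else if i = Suc c then b i else 0 else 0)"
  using assms by (auto simp: u_gen_def chev_e_def chev_f_def elem_mat_def)

lemma u_gen_carrier [simp]: "u_gen n b i \<in> carrier_mat n n"
  by (auto simp: u_gen_def chev_e_def chev_f_def elem_mat_def)

lemma u_gen_dim [simp]: "dim_row (u_gen n b i) = n" "dim_col (u_gen n b i) = n"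
  using carrier_matD[OF u_gen_carrier] by auto

lemma u_gen_mult_vec:
  assumes "i < n - 1" "v \<in> carrier_vec n"
  shows "u_gen n b (Suc i) *\<^sub>v v = u_functional b i v \<cdot>\<^sub>v unit_vec n i"
proof (rule eq_vecI)
  fix r assume "r < dim_vec (u_functional b i v \<cdot>\<^sub>v unit_vec n i)"
  then have r: "r < n" by simp
  have "(u_gen n b (Suc i) *\<^sub>v v) $ r = (\<Sum>c<n. u_gen n b (Suc i) $$ (r, c) * v $ c)"
    using r assms
    by (auto simp: scalar_prod_def lessThan_atLeast0)
  also have "\<dots> = (\<Sum>c<n. (if c = Suc i then if r = i then v $ c else 0 else 0) +
      (if c = i - 1 then if r = i \<and> i \<noteq> 0 then b i * v $ c else 0 else 0))"
    using r by (intro sum.cong) (auto simp: u_gen_index)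
  also have "\<dots> = (u_functional b i v \<cdot>\<^sub>v unit_vec n i) $ r"
    using r assms by (auto simp: sum.distrib sum.delta u_functional_def)
  finally show "(u_gen n b (Suc i) *\<^sub>v v) $ r = (u_functional b i v \<cdot>\<^sub>v unit_vec n i) $ r" .
qed simp

text \<open>Row \<open>i\<close> of J has c_{i+1} right of the diagonal and, for
  \<open>i > 0\<close>, -c_i left of it; the recursion turns -c_i into b_i c_{i+1}. The last row
  corresponds to no generator.\<close>

lemma gram_mult_vec_functional:
  assumes "i < n - 1" "v \<in> carrier_vec n"
  shows "(gram n b *\<^sub>v v) $ i = omega_coeff n b (Suc i) * u_functional b i v"
  using assms omega_coeff_step[of i n b]
  by (auto simp: gram_mult_vec u_functional_def algebra_simps simp del: index_mult_mat_vec)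

text \<open>Hence \<open>omega_coeff n b i\<close> times the \<open>i\<close>-th generator is the transvection
  \<open>v \<mapsto> \<omega>(e\<^sub>i, v) e\<^sub>i\<close>.\<close>

lemma gram_row_u_gen:
  assumes "i < n - 1" "c < n"
  shows "gram n b $$ (i, c) = omega_coeff n b (Suc i) * u_gen n b (Suc i) $$ (i, c)"
  using assms omega_coeff_step[of i n b] by (auto simp: gram_def u_gen_index)

text \<open>With phi = \<open>u_functional b i\<close>, the two terms are c_{i+1} phi(v) phi(w) and,
  by skewness, its negative.\<close>

lemma u_gen_preserves:
  assumes i: "i < n - 1"
  shows "preserves n (u_gen n b (Suc i)) (omega_b n b)"
  unfolding preserves_def
proof (intro ballI)
  fix v w :: "complex vec" assume v: "v \<in> carrier_vec n" and w: "w \<in> carrier_vec n"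
  have "omega_b n b (unit_vec n i) v = omega_coeff n b (Suc i) * u_functional b i v"
    "omega_b n b (unit_vec n i) w = omega_coeff n b (Suc i) * u_functional b i w"
    using i v w by (simp_all add: omega_b_unit_left gram_mult_vec_functional del: index_mult_mat_vec)
  then show "omega_b n b (u_gen n b (Suc i) *\<^sub>v v) w + omega_b n b v (u_gen n b (Suc i) *\<^sub>v w) = 0"
    using i v w omega_b_swap[of n b v "unit_vec n i"]
    by (simp add: u_gen_mult_vec omega_b_smult_left omega_b_smult_right)
qed

section \<open>Lie subalgebras containing the generators\<close>

lemma lie_bracket_mult_vec:
  assumes "x \<in> carrier_mat n n" "y \<in> carrier_mat n n" "v \<in> carrier_vec n"
  shows "lie_bracket x y *\<^sub>v v = x *\<^sub>v (y *\<^sub>v v) - y *\<^sub>v (x *\<^sub>v v)"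
  using assms by (simp add: lie_bracket_def minus_mult_distrib_mat_vec[of _ n n]
      assoc_mult_mat_vec[of _ n n _ n])

lemma smult_mat_mult_vec:
  fixes x :: "complex mat"
  assumes "x \<in> carrier_mat n n" "v \<in> carrier_vec n"
  shows "(c \<cdot>\<^sub>m x) *\<^sub>v v = c \<cdot>\<^sub>v (x *\<^sub>v v)"
  using assms by (intro eq_vecI) auto

lemma lie_subalgebra_sp_omega_b: "lie_subalgebra n (sp_form n (omega_b n b))"
proof -
  let ?w = "omega_b n b"
  have zero: "preserves n (0\<^sub>m n n) ?w"
    unfolding preserves_def
  proof (intro ballI)
    fix v w :: "complex vec" assume v: "v \<in> carrier_vec n" and w: "w \<in> carrier_vec n"
    have "0\<^sub>m n n *\<^sub>v v = 0\<^sub>v n" "0\<^sub>m n n *\<^sub>v w = 0\<^sub>v n"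
      using v w by (auto intro!: eq_vecI)
    then show "?w (0\<^sub>m n n *\<^sub>v v) w + ?w v (0\<^sub>m n n *\<^sub>v w) = 0"
      using v w by (simp add: omega_b_gram mult_mat_vec_carrier[of _ n n])
  qed
  have add: "preserves n (x + y) ?w"
    if "x \<in> carrier_mat n n" "y \<in> carrier_mat n n" "preserves n x ?w" "preserves n y ?w" for x y
    unfolding preserves_def
  proof (intro ballI)
    fix v w :: "complex vec" assume v: "v \<in> carrier_vec n" and w: "w \<in> carrier_vec n"
    have "?w (x *\<^sub>v v) w + ?w v (x *\<^sub>v w) = 0" "?w (y *\<^sub>v v) w + ?w v (y *\<^sub>v w) = 0"
      using that v w by (auto simp: preserves_def)
    moreover have "?w ((x + y) *\<^sub>v v) w + ?w v ((x + y) *\<^sub>v w) =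
        (?w (x *\<^sub>v v) w + ?w v (x *\<^sub>v w)) + (?w (y *\<^sub>v v) w + ?w v (y *\<^sub>v w))"
      using that v w
      by (simp add: add_mult_distrib_mat_vec[of _ n n] omega_b_add_left omega_b_add_right)
    ultimately show "?w ((x + y) *\<^sub>v v) w + ?w v ((x + y) *\<^sub>v w) = 0" by simp
  qed
  have smult: "preserves n (c \<cdot>\<^sub>m x) ?w" if "x \<in> carrier_mat n n" "preserves n x ?w" for c x
    using that
    by (auto simp: preserves_def smult_mat_mult_vec omega_b_smult_left omega_b_smult_right
        simp flip: distrib_left)
  have bracket: "preserves n (lie_bracket x y) ?w"
    if x: "x \<in> carrier_mat n n" and y: "y \<in> carrier_mat n n"
      and px: "preserves n x ?w" and py: "preserves n y ?w" for x y
    unfolding preserves_def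
  proof (intro ballI)
    fix v w :: "complex vec" assume v: "v \<in> carrier_vec n" and w: "w \<in> carrier_vec n"
    \<comment> \<open>Moving both factors across the form gives \<omega>([x,y]v, w) = \<omega>(v,
      [y,x]w), which is the claim.\<close>
    have p: "?w (x *\<^sub>v p) q = - ?w p (x *\<^sub>v q)" "?w (y *\<^sub>v p) q = - ?w p (y *\<^sub>v q)"
      if "p \<in> carrier_vec n" "q \<in> carrier_vec n" for p q
      using px py that by (auto simp: preserves_def eq_neg_iff_add_eq_0)
    have m: "p - q = p + (-1) \<cdot>\<^sub>v q" if "p \<in> carrier_vec n" "q \<in> carrier_vec n"
      for p q :: "complex vec"
      using that by (intro eq_vecI) auto
    show "?w (lie_bracket x y *\<^sub>v v) w + ?w v (lie_bracket x y *\<^sub>v w) = 0"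
      using x y v w
      by (simp add: lie_bracket_mult_vec m omega_b_add_left omega_b_add_right omega_b_smult_left
          omega_b_smult_right p)
  qed
  show ?thesis
    using lie_subalgebra_sl[of n] zero add smult bracket
    by (auto simp: lie_subalgebra_def sp_form_def sl_def)
qed

lemma lie_subalgebra_sl_annihilator:
  assumes v: "v \<in> carrier_vec n"
  shows "lie_subalgebra n (sl n \<inter> annihilator n v)"
proof -
  have "(x + y) *\<^sub>v v = 0\<^sub>v n" "lie_bracket x y *\<^sub>v v = 0\<^sub>v n" "(c \<cdot>\<^sub>m x) *\<^sub>v v = 0\<^sub>v n"
    if "x \<in> carrier_mat n n" "y \<in> carrier_mat n n" "x *\<^sub>v v = 0\<^sub>v n" "y *\<^sub>v v = 0\<^sub>v n" for x y c
    using that v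
    by (auto simp: lie_bracket_mult_vec smult_mat_mult_vec add_mult_distrib_mat_vec[of _ n n])
  then show ?thesis
    using lie_subalgebra_sl[of n] v
    by (auto simp: lie_subalgebra_def annihilator_def sl_def)
qed

lemma sl_b_minimal:
  assumes "lie_subalgebra n L" "\<And>i. i < n - 1 \<Longrightarrow> u_gen n b (Suc i) \<in> L"
  shows "sl_b n b \<subseteq> L"
  unfolding sl_b_def
proof (rule hull_minimal)
  show "u_gen n b ` {1..n - 1} \<subseteq> L"
  proof
    fix x assume "x \<in> u_gen n b ` {1..n - 1}"
    then obtain i where "i \<in> {1..n - 1}" "x = u_gen n b i" by auto
    then show "x \<in> L" using assms(2)[of "i - 1"] by auto
  qed
qed (rule assms(1))

lemma u_gen_in_sl_b: "i < n - 1 \<Longrightarrow> u_gen n b (Suc i) \<in> sl_b n b"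
  unfolding sl_b_def by (rule hull_inc) auto

lemma sl_b_subset_sp: "sl_b n b \<subseteq> sp_form n (omega_b n b)"
  using lie_subalgebra_sp_omega_b
  by (rule sl_b_minimal) (auto simp: sp_form_def u_gen_preserves intro!: u_gen_in_sl)

section \<open>The vector v^1 and its annihilation by the generators\<close>

lemma v_one_carrier [simp]: "v_one n b \<in> carrier_vec n"
  unfolding v_one_def by (rule finsum_vec_closed) (auto simp: basis_vec_def)

lemma v_one_dim [simp]: "dim_vec (v_one n b) = n"
  using v_one_carrier by (rule carrier_vecD)

lemma v_one_index:
  assumes "j < n"
  shows "v_one n b $ j =
    (if even j then (-1) ^ (j div 2) * (\<Prod>l = 1..j div 2. b (2 * l - 1)) else 0)"
proof -
  let ?a = "\<lambda>m. (-1) ^ m * (\<Prod>l = 1..m. b (2 * l - 1))"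
  have "v_one n b $ j = (\<Sum>m<(n + 1) div 2. (?a m \<cdot>\<^sub>v basis_vec n (2 * m + 1)) $ j)"
    unfolding v_one_def
    by (rule index_finsum_vec) (use assms in \<open>auto simp: basis_vec_def\<close>)
  also have "\<dots> = (\<Sum>m<(n + 1) div 2. if m = j div 2 then if even j then ?a m else 0 else 0)"
    using assms by (intro sum.cong) (auto simp: basis_vec_def)
  also have "\<dots> = (if even j then ?a (j div 2) else 0)"
    using assms by (subst sum.delta) auto
  finally show ?thesis by simp
qed

text \<open>For even \<open>j\<close> the product gains the factor \<open>b (Suc j)\<close> and a
  sign; for odd \<open>j\<close> both coordinates vanish.\<close>

lemma v_one_Suc_Suc:
  assumes "Suc (Suc j) < n"
  shows "v_one n b $ Suc (Suc j) = - b (Suc j) * v_one n b $ j"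
  using assms by (auto simp: v_one_index elim!: evenE)

text \<open>At \<open>i = 0\<close> the functional reads off the second coordinate, which is 0; at
  \<open>i = Suc j\<close> its vanishing is the two-step recursion of v^1.\<close>

lemma u_functional_v_one:
  assumes "i < n - 1"
  shows "u_functional b i (v_one n b) = 0"
proof (cases i)
  case 0
  then show ?thesis using assms by (simp add: u_functional_def v_one_index)
next
  case (Suc j)
  then show ?thesis using assms v_one_Suc_Suc[of j n b] by (simp add: u_functional_def)
qed

lemma sl_b_v_one: "sl_b n b \<subseteq> annihilator n (v_one n b)"
proof -
  have "sl_b n b \<subseteq> sl n \<inter> annihilator n (v_one n b)"
  proof (rule sl_b_minimal)
    fix i assume i: "i < n - 1"
    have "u_gen n b (Suc i) *\<^sub>v v_one n b = 0\<^sub>v n"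
      using i by (intro eq_vecI) (simp_all add: u_gen_mult_vec u_functional_v_one)
    then show "u_gen n b (Suc i) \<in> sl n \<inter> annihilator n (v_one n b)"
      using i u_gen_in_sl[of "Suc i" n b] by (simp add: annihilator_def)
  qed (simp add: lie_subalgebra_sl_annihilator)
  then show ?thesis by simp
qed

lemma v_one_nonzero: "0 < n \<Longrightarrow> v_one n b \<noteq> 0\<^sub>v n"
  using v_one_index[of 0 n b] by auto

subsection \<open>The symmetric square inside the generated algebra\<close>

lemma mult_mat_index_sum:
  assumes "x \<in> carrier_mat n n" "y \<in> carrier_mat n n" "r < n" "c < n"
  shows "(x * y) $$ (r, c) = (\<Sum>t<n. x $$ (r, t) * y $$ (t, c))"
  using assms by (auto simp: scalar_prod_def lessThan_atLeast0)

text \<open>The matrix \<open>sym_elem n b i j\<close> is \<open>(E\<^sub>i\<^sub>j + E\<^sub>j\<^sub>i) J\<close> with \<open>J = gram n b\<close>: it corresponds to the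
  product \<open>e\<^sub>i e\<^sub>j\<close> under the isomorphism of the symplectic Lie algebra with the symmetric square.\<close>

definition sym_elem :: "nat \<Rightarrow> (nat \<Rightarrow> complex) \<Rightarrow> nat \<Rightarrow> nat \<Rightarrow> complex mat" where
  "sym_elem n b i j = mat n n (\<lambda>(r, c).
     (if r = i then gram n b $$ (j, c) else 0) + (if r = j then gram n b $$ (i, c) else 0))"

lemma sym_elem_carrier [simp]: "sym_elem n b i j \<in> carrier_mat n n"
  by (simp add: sym_elem_def)

lemma sym_elem_dim [simp]: "dim_row (sym_elem n b i j) = n" "dim_col (sym_elem n b i j) = n"
  by (simp_all add: sym_elem_def)

lemma sym_elem_index:
  "r < n \<Longrightarrow> c < n \<Longrightarrow> sym_elem n b i j $$ (r, c) =
     (if r = i then gram n b $$ (j, c) else 0) + (if r = j then gram n b $$ (i, c) else 0)"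
  by (simp add: sym_elem_def)

lemma sym_elem_commute: "sym_elem n b i j = sym_elem n b j i"
  by (rule eq_matI) (auto simp: sym_elem_def)

text \<open>The two summands coincide, hence the factor 2. The squares e_i^2 with
  \<open>i < n - 1\<close> are thus multiples of generators, from which the generation argument
  starts.\<close>

lemma sym_elem_diag:
  assumes "i < n - 1"
  shows "sym_elem n b i i = (2 * omega_coeff n b (Suc i)) \<cdot>\<^sub>m u_gen n b (Suc i)"
proof (rule eq_matI)
  fix r c
  assume "r < dim_row ((2 * omega_coeff n b (Suc i)) \<cdot>\<^sub>m u_gen n b (Suc i))"
    "c < dim_col ((2 * omega_coeff n b (Suc i)) \<cdot>\<^sub>m u_gen n b (Suc i))"
  then have "r < n" "c < n" by simp_all
  then show "sym_elem n b i i $$ (r, c) =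
      ((2 * omega_coeff n b (Suc i)) \<cdot>\<^sub>m u_gen n b (Suc i)) $$ (r, c)"
    using assms
    by (auto simp: sym_elem_index gram_row_u_gen u_gen_index)
qed simp_all

text \<open>In the symmetric square this is the Leibniz rule for the Poisson bracket with {e_i, e_j}
  = J_ij: {e_i e_j, e_k^2} = 2 e_k (J_jk e_i + J_ik e_j).\<close>

lemma bracket_sym_elem_diag:
  assumes "i < n" "j < n" "k < n"
  shows "lie_bracket (sym_elem n b i j) (sym_elem n b k k) =
     (2 * gram n b $$ (j, k)) \<cdot>\<^sub>m sym_elem n b i k + (2 * gram n b $$ (i, k)) \<cdot>\<^sub>m sym_elem n b j k"
proof (rule eq_matI)
  let ?J = "gram n b" and ?S = "sym_elem n b"
  fix r c
  assume "r < dim_row ((2 * ?J $$ (j, k)) \<cdot>\<^sub>m ?S i k + (2 * ?J $$ (i, k)) \<cdot>\<^sub>m ?S j k)"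
    "c < dim_col ((2 * ?J $$ (j, k)) \<cdot>\<^sub>m ?S i k + (2 * ?J $$ (i, k)) \<cdot>\<^sub>m ?S j k)"
  then have rc: "r < n" "c < n" by (simp_all add: sym_elem_def)
  have "(?S i j * ?S k k) $$ (r, c) =
      (\<Sum>t<n. if t = k then 2 * ?S i j $$ (r, k) * ?J $$ (k, c) else 0)"
  proof -
    have "?S k k $$ (t, c) = (if t = k then 2 * ?J $$ (k, c) else 0)" if "t < n" for t
      using that rc by (simp add: sym_elem_index)
    then have "(\<Sum>t<n. ?S i j $$ (r, t) * ?S k k $$ (t, c)) =
        (\<Sum>t<n. if t = k then 2 * ?S i j $$ (r, k) * ?J $$ (k, c) else 0)"
      by (intro sum.cong) auto
    then show ?thesis
      using rc mult_mat_index_sum[OF sym_elem_carrier sym_elem_carrier rc] by metis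
  qed
  then have 1: "(?S i j * ?S k k) $$ (r, c) = 2 * ?S i j $$ (r, k) * ?J $$ (k, c)"
    using assms by (simp add: sum.delta)
  have "(?S k k * ?S i j) $$ (r, c) =
      (\<Sum>t<n. (if t = i then if r = k then 2 * ?J $$ (k, i) * ?J $$ (j, c) else 0 else 0) +
              (if t = j then if r = k then 2 * ?J $$ (k, j) * ?J $$ (i, c) else 0 else 0))"
  proof -
    have "?S k k $$ (r, t) * ?S i j $$ (t, c) =
        (if t = i then if r = k then 2 * ?J $$ (k, i) * ?J $$ (j, c) else 0 else 0) +
        (if t = j then if r = k then 2 * ?J $$ (k, j) * ?J $$ (i, c) else 0 else 0)" if "t < n" for t
      using that rc by (simp add: sym_elem_index)
    then show ?thesis
      using mult_mat_index_sum[OF sym_elem_carrier sym_elem_carrier rc] by simp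
  qed
  then have 2: "(?S k k * ?S i j) $$ (r, c) =
      (if r = k then 2 * (?J $$ (k, i) * ?J $$ (j, c) + ?J $$ (k, j) * ?J $$ (i, c)) else 0)"
    using assms by (simp add: sum.distrib sum.delta)
  have "lie_bracket (?S i j) (?S k k) $$ (r, c) =
      (?S i j * ?S k k) $$ (r, c) - (?S k k * ?S i j) $$ (r, c)"
    using rc by (simp add: lie_bracket_def sym_elem_def)
  also have "\<dots> = ((2 * ?J $$ (j, k)) \<cdot>\<^sub>m ?S i k + (2 * ?J $$ (i, k)) \<cdot>\<^sub>m ?S j k) $$ (r, c)"
  proof -
    have rhs: "((2 * ?J $$ (j, k)) \<cdot>\<^sub>m ?S i k + (2 * ?J $$ (i, k)) \<cdot>\<^sub>m ?S j k) $$ (r, c) =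
      2 * ?J $$ (j, k) * ?S i k $$ (r, c) + 2 * ?J $$ (i, k) * ?S j k $$ (r, c)"
      using rc by simp
    \<comment> \<open>Scalar Kronecker deltas replace the case distinction on whether
      \<open>r\<close> equals \<open>i\<close>, \<open>j\<close> or \<open>k\<close>, so that ring
      arithmetic suffices.\<close>
    define \<delta> :: "nat \<Rightarrow> complex" where "\<delta> l = (if r = l then 1 else 0)" for l
    have S: "?S l m $$ (r, d) = \<delta> l * ?J $$ (m, d) + \<delta> m * ?J $$ (l, d)" if "d < n" for l m d
      using that rc by (simp add: sym_elem_index \<delta>_def)
    have kk: "(?S k k * ?S i j) $$ (r, c) =
        \<delta> k * (2 * (- ?J $$ (i, k) * ?J $$ (j, c) + - ?J $$ (j, k) * ?J $$ (i, c)))"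
      using assms gram_skew[of k n i b] gram_skew[of k n j b] unfolding 2 by (simp add: \<delta>_def)
    show ?thesis
      unfolding 1 kk rhs using rc assms by (simp add: S algebra_simps)
  qed
  finally show "lie_bracket (?S i j) (?S k k) $$ (r, c) =
    ((2 * ?J $$ (j, k)) \<cdot>\<^sub>m ?S i k + (2 * ?J $$ (i, k)) \<cdot>\<^sub>m ?S j k) $$ (r, c)" .
qed (simp_all add: sym_elem_def lie_bracket_def)

lemma lie_subalgebra_smult_cancel:
  assumes "lie_subalgebra n L" "x \<in> carrier_mat n n" "c \<cdot>\<^sub>m x \<in> L" "c \<noteq> 0"
  shows "x \<in> L"
proof -
  have "inverse c \<cdot>\<^sub>m (c \<cdot>\<^sub>m x) \<in> L"
    using assms by (simp add: lie_subalgebra_def)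
  moreover have "inverse c \<cdot>\<^sub>m (c \<cdot>\<^sub>m x) = x"
    using assms by (intro eq_matI) auto
  ultimately show ?thesis by simp
qed

text \<open>Induction on \<open>j\<close>, starting from the generator multiple
  \<open>sym_elem n b i i\<close>: bracketing with the square at \<open>Suc j\<close> raises the
  second index by one, because J_{j,j+1} = c_{j+1} is nonzero.\<close>

lemma sym_elem_in_sl_b:
  assumes nz: "\<And>k. 0 < k \<Longrightarrow> k < n \<Longrightarrow> omega_coeff n b k \<noteq> 0"
    and ij: "i \<le> j" "j < n - 1"
  shows "sym_elem n b i j \<in> sl_b n b"
  using ij
proof (induction j rule: dec_induct)
  case base
  then show ?case
    using lie_subalgebra_sl_b[of n b] u_gen_in_sl_b[of i n b]
    by (simp add: sym_elem_diag lie_subalgebra_def)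
next
  case (step j)
  let ?k = "Suc j" and ?c = "omega_coeff n b (Suc j)"
  have c: "?c \<noteq> 0" using nz step.prems by simp
  have k: "gram n b $$ (j, ?k) = ?c" using step.prems by (simp add: gram_def)
  have "sym_elem n b ?k ?k \<in> sl_b n b"
    using lie_subalgebra_sl_b[of n b] u_gen_in_sl_b[of ?k n b] step.prems
    by (simp add: sym_elem_diag lie_subalgebra_def)
  then have br: "lie_bracket (sym_elem n b i j) (sym_elem n b ?k ?k) \<in> sl_b n b"
    using lie_subalgebra_sl_b[of n b] step by (simp add: lie_subalgebra_def)
  \<comment> \<open>For \<open>i = j\<close> the two terms of the bracket coincide, which doubles
    the factor; for \<open>i < j\<close> the tridiagonal shape of J kills the second one.\<close>
  have "\<exists>a. a \<noteq> 0 \<and> lie_bracket (sym_elem n b i j) (sym_elem n b ?k ?k) =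
      a \<cdot>\<^sub>m sym_elem n b i ?k"
  proof (cases "i = j")
    case True
    then have "lie_bracket (sym_elem n b i j) (sym_elem n b ?k ?k) =
        (4 * ?c) \<cdot>\<^sub>m sym_elem n b i ?k"
      using step.prems k by (subst bracket_sym_elem_diag)
        (auto intro!: eq_matI simp: sym_elem_def)
    then show ?thesis using c by (intro exI[of _ "4 * ?c"]) simp
  next
    case False
    then have "gram n b $$ (i, ?k) = 0" using step by (auto simp: gram_def)
    then have "lie_bracket (sym_elem n b i j) (sym_elem n b ?k ?k) =
        (2 * ?c) \<cdot>\<^sub>m sym_elem n b i ?k"
      using step k by (subst bracket_sym_elem_diag)
        (auto intro!: eq_matI simp: sym_elem_def)
    then show ?thesis using c by (intro exI[of _ "2 * ?c"]) simp
  qed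
  then show ?case
    using br lie_subalgebra_smult_cancel[OF lie_subalgebra_sl_b sym_elem_carrier] by metis
qed

lemma lie_subalgebra_sum:
  assumes L: "lie_subalgebra n L" and "finite I" "\<And>i. i \<in> I \<Longrightarrow> f i \<in> L"
  shows "mat n n (\<lambda>rc. \<Sum>i\<in>I. f i $$ rc) \<in> L"
  using assms(2,3)
proof (induction I)
  case empty
  have "mat n n (\<lambda>rc. \<Sum>i\<in>{}. f i $$ rc) = 0\<^sub>m n n" by (rule eq_matI) auto
  with L show ?case by (simp add: lie_subalgebra_def)
next
  case (insert i I)
  have car: "f i \<in> carrier_mat n n"
    using L insert.prems by (auto simp: lie_subalgebra_def sl_def)
  have "mat n n (\<lambda>rc. \<Sum>i\<in>insert i I. f i $$ rc) = f i + mat n n (\<lambda>rc. \<Sum>i\<in>I. f i $$ rc)"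
    using car insert.hyps by (intro eq_matI) auto
  then show ?case using L insert by (auto simp: lie_subalgebra_def)
qed

lemma symmetric_mult_gram_in_sl_b:
  assumes nz: "\<And>k. 0 < k \<Longrightarrow> k < n \<Longrightarrow> omega_coeff n b k \<noteq> 0"
    and A: "A \<in> carrier_mat n n" "A\<^sup>T = A" "\<And>i. i < n \<Longrightarrow> A $$ (i, n - 1) = 0"
  shows "A * gram n b \<in> sl_b n b"
proof -
  let ?J = "gram n b" and ?S = "sym_elem n b"
  \<comment> \<open>The half corrects double counting: \<open>(i, j)\<close> and
    \<open>(j, i)\<close> give the same matrix, and \<open>?S i i\<close> already carries a factor
    2.\<close>
  let ?f = "\<lambda>(i, j). (A $$ (i, j) / 2) \<cdot>\<^sub>m ?S i j"
  have sym: "A $$ (i, j) = A $$ (j, i)" if "i < n" "j < n" for i j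
    using that A(1) arg_cong[OF A(2), of "\<lambda>M. M $$ (i, j)"] by simp
  have "mat n n (\<lambda>rc. \<Sum>p\<in>{..<n} \<times> {..<n}. ?f p $$ rc) \<in> sl_b n b"
  proof (rule lie_subalgebra_sum[OF lie_subalgebra_sl_b])
    fix p assume "p \<in> {..<n} \<times> {..<n}"
    then obtain i j where p: "p = (i, j)" "i < n" "j < n" by auto
    show "?f p \<in> sl_b n b"
    proof (cases "i < n - 1 \<and> j < n - 1")
      case True
      then have "?S i j \<in> sl_b n b"
        using sym_elem_in_sl_b[OF nz, of i j] sym_elem_in_sl_b[OF nz, of j i]
        by (cases "i \<le> j") (auto simp: sym_elem_commute[of n b i j])
      then show ?thesis using lie_subalgebra_sl_b[of n b] p by (simp add: lie_subalgebra_def)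
    next
      case False
      \<comment> \<open>Symmetry of \<open>A\<close> extends the vanishing of the last column to the
        last row, so only products of e_i, e_j with \<open>i, j < n - 1\<close> occur.\<close>
      then have "i = n - 1 \<or> j = n - 1" using p by auto
      then have "A $$ (i, j) = 0" using A(3) sym p by metis
      then have "?f p = 0\<^sub>m n n" using p by (auto intro!: eq_matI simp: sym_elem_def)
      then show ?thesis using lie_subalgebra_sl_b[of n b] by (simp add: lie_subalgebra_def)
    qed
  qed simp
  also have "mat n n (\<lambda>rc. \<Sum>p\<in>{..<n} \<times> {..<n}. ?f p $$ rc) = A * ?J"
  proof (rule eq_matI)
    fix r c assume "r < dim_row (A * ?J)" "c < dim_col (A * ?J)"
    then have rc: "r < n" "c < n" using A by auto
    have "(\<Sum>p\<in>{..<n} \<times> {..<n}. ?f p $$ (r, c)) = (\<Sum>i<n. \<Sum>j<n. ?f (i, j) $$ (r, c))"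
      by (auto simp: sum.cartesian_product intro!: sum.cong)
    also have "\<dots> = (\<Sum>i<n. \<Sum>j<n. (if i = r then A $$ (r, j) / 2 * ?J $$ (j, c) else 0) +
        (if j = r then A $$ (i, r) / 2 * ?J $$ (i, c) else 0))"
      using rc
      by (intro sum.cong) (auto simp: sym_elem_index algebra_simps)
    also have "\<dots> = (\<Sum>j<n. A $$ (r, j) / 2 * ?J $$ (j, c)) + (\<Sum>i<n. A $$ (i, r) / 2 * ?J $$ (i, c))"
    proof -
      have "(\<Sum>i<n. \<Sum>j<n. if i = r then A $$ (r, j) / 2 * ?J $$ (j, c) else 0) =
          (\<Sum>j<n. A $$ (r, j) / 2 * ?J $$ (j, c))"
        using rc by (subst sum.swap) (simp add: sum.delta)
      then show ?thesis using rc by (simp add: sum.distrib sum.delta)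
    qed
    also have "\<dots> = (\<Sum>j<n. A $$ (r, j) * ?J $$ (j, c))"
      using rc by (auto simp: sum.distrib[symmetric] sym[of _ r] intro!: sum.cong)
    also have "\<dots> = (A * ?J) $$ (r, c)"
      using A rc by (simp add: mult_mat_index_sum[of _ n] del: index_mult_mat)
    finally show "mat n n (\<lambda>rc. \<Sum>p\<in>{..<n} \<times> {..<n}. ?f p $$ rc) $$ (r, c) = (A * ?J) $$ (r, c)"
      using rc by simp
  qed (use A in auto)
  finally show ?thesis .
qed

subsection \<open>Nondegeneracy and the description of the generated algebra\<close>

lemma inverse_of_injective:
  fixes M :: "complex mat"
  assumes M: "M \<in> carrier_mat n n" and inj: "\<And>v. v \<in> carrier_vec n \<Longrightarrow> M *\<^sub>v v = 0\<^sub>v n \<Longrightarrow> v = 0\<^sub>v n"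
  obtains K where "K \<in> carrier_mat n n" "M * K = 1\<^sub>m n" "K * M = 1\<^sub>m n"
proof -
  have "det M \<noteq> 0" using det_0_iff_vec_prod_zero_field[OF M] inj by blast
  then have "M \<in> Units (ring_mat TYPE(complex) n ())" by (rule det_non_zero_imp_unit[OF M])
  then show thesis using that by (auto simp: Units_def ring_mat_def)
qed

text \<open>If c_1 = 0, the first column of J vanishes and the first basis vector lies in the
  kernel. Since c_1 contains every factor \<open>- b i\<close>, nondegeneracy makes all c_k with
  \<open>0 < k < n\<close> nonzero.\<close>

lemma nondegenerate_omega_coeff_nonzero:
  assumes "n \<ge> 2" "nondegenerate n (omega_b n b)"
  shows "omega_coeff n b 1 \<noteq> 0"
proof
  assume 0: "omega_coeff n b 1 = 0"
  have "gram n b *\<^sub>v unit_vec n 0 = 0\<^sub>v n"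
    using assms(1) 0 by (intro eq_vecI) (auto simp: gram_mult_vec le_Suc_eq simp del: index_mult_mat_vec)
  then have "unit_vec n 0 \<in> form_kernel n (omega_b n b)" by (simp add: form_kernel_omega_b)
  then have "unit_vec n 0 = (0\<^sub>v n :: complex vec)" using assms(2) by (simp add: nondegenerate_def)
  then have "unit_vec n 0 $ 0 = (0\<^sub>v n :: complex vec) $ 0" by simp
  then show False using assms(1) by simp
qed

text \<open>The kernel equations relate coordinates of the same parity only and are solved from both ends
  (counting from 1): \<open>v\<^sub>2 = 0\<close> is propagated upwards and \<open>v\<^bsub>n-1\<^esub> = 0\<close> downwards.\<close>

lemma nondegenerate_omega_b:
  assumes n: "n \<ge> 2" "even n" and nz: "\<And>k. 0 < k \<Longrightarrow> k < n \<Longrightarrow> omega_coeff n b k \<noteq> 0"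
  shows "nondegenerate n (omega_b n b)"
proof -
  have "v = 0\<^sub>v n" if v: "v \<in> carrier_vec n" and ker: "gram n b *\<^sub>v v = 0\<^sub>v n" for v
  proof -
    have eq: "(if Suc r < n then omega_coeff n b (Suc r) * v $ Suc r else 0) =
        (if r = 0 then 0 else omega_coeff n b r * v $ (r - 1))" if "r < n" for r
      using gram_mult_vec[OF v that, of b] ker that by simp
    have up: "v $ (2 * k + 1) = 0" if "2 * k + 1 < n" for k
      using that
    proof (induction k)
      case 0
      then show ?case using eq[of 0] nz[of 1] by simp
    next
      case (Suc k)
      then show ?case using eq[of "2 * k + 2"] nz[of "2 * k + 3"] by (simp add: numeral_3_eq_3)
    qed
    have down: "v $ (n - 2 * k - 2) = 0" if "2 * k + 2 \<le> n" for k
      using that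
    proof (induction k)
      case 0
      then show ?case using eq[of "n - 1"] nz[of "n - 1"] n by (auto simp: numeral_2_eq_2)
    next
      case (Suc k)
      let ?r = "n - 2 * k - 3"
      have "Suc ?r = n - 2 * k - 2" "?r - 1 = n - 2 * Suc k - 2" using Suc.prems by auto
      then show ?case using eq[of ?r] nz[of ?r] Suc by auto
    qed
    show ?thesis
    proof (rule eq_vecI)
      fix i assume "i < dim_vec (0\<^sub>v n :: complex vec)"
      then have i: "i < n" by simp
      show "v $ i = 0\<^sub>v n $ i"
      proof (cases "even i")
        case True
        with n obtain k m where km: "i = 2 * k" "n = 2 * m" by (auto elim!: evenE)
        \<comment> \<open>\<open>m - k - 1\<close> counts the steps of length two from coordinate
          \<open>n - 2\<close> down to \<open>i\<close>.\<close>
        then have "n - 2 * (m - k - 1) - 2 = i" "2 * (m - k - 1) + 2 \<le> n" using i by auto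
        with down[of "m - k - 1"] i show ?thesis by simp
      next
        case False
        then obtain k where "i = 2 * k + 1" by (auto elim!: oddE)
        with up[of k] i show ?thesis by simp
      qed
    qed (use v in simp)
  qed
  then show ?thesis by (auto simp: nondegenerate_def form_kernel_omega_b)
qed

text \<open>Infinitesimal invariance and skewness make (v, w) -> \<omega>(v, x w) a symmetric form,
  and its Gram matrix is J x.\<close>

lemma preserves_gram_symmetric:
  assumes x: "x \<in> carrier_mat n n" "preserves n x (omega_b n b)"
  shows "(gram n b * x)\<^sup>T = gram n b * x"
proof (rule eq_matI)
  fix i j assume "i < dim_row (gram n b * x)" "j < dim_col (gram n b * x)"
  then have ij: "i < n" "j < n" using x by auto
  have entry: "omega_b n b (unit_vec n k) (x *\<^sub>v unit_vec n l) = (gram n b * x) $$ (k, l)"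
    if "k < n" "l < n" for k l
  proof -
    have "omega_b n b (unit_vec n k) (x *\<^sub>v unit_vec n l) = (gram n b *\<^sub>v (x *\<^sub>v unit_vec n l)) $ k"
      using that x by (intro omega_b_unit_left) auto
    also have "gram n b *\<^sub>v (x *\<^sub>v unit_vec n l) = (gram n b * x) *\<^sub>v unit_vec n l"
      using x by (intro assoc_mult_mat_vec[symmetric]) auto
    also have "\<dots> $ k = (gram n b * x) $$ (k, l)"
      using that x by simp
    finally show ?thesis .
  qed
  have "omega_b n b (x *\<^sub>v unit_vec n i) (unit_vec n j) +
      omega_b n b (unit_vec n i) (x *\<^sub>v unit_vec n j) = 0"
    using x by (simp add: preserves_def)
  then have "(gram n b * x) $$ (i, j) = (gram n b * x) $$ (j, i)"
    using ij entry omega_b_swap[of n b "x *\<^sub>v unit_vec n i"] by simp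
  then show "(gram n b * x)\<^sup>T $$ (i, j) = (gram n b * x) $$ (i, j)"
    using ij x by simp
qed (use x in auto)

lemma sl_b_eq:
  assumes n: "n \<ge> 2" and nd: "nondegenerate n (omega_b n b)"
  shows "sl_b n b = sp_form n (omega_b n b) \<inter> annihilator n (v_one n b)"
proof
  show "sl_b n b \<subseteq> sp_form n (omega_b n b) \<inter> annihilator n (v_one n b)"
    using sl_b_subset_sp sl_b_v_one by blast
next
  let ?J = "gram n b" and ?v = "v_one n b"
  have nz: "omega_coeff n b k \<noteq> 0" if "0 < k" "k < n" for k
    using nondegenerate_omega_coeff_nonzero[OF n nd] that
      omega_coeff_nonzero[of b 1 n k] by (simp add: omega_coeff_def)
  have inj: "w = 0\<^sub>v n" if "w \<in> carrier_vec n" "?J *\<^sub>v w = 0\<^sub>v n" for w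
    using nd that by (auto simp: nondegenerate_def form_kernel_omega_b)
  obtain K where K: "K \<in> carrier_mat n n" "?J * K = 1\<^sub>m n" "K * ?J = 1\<^sub>m n"
    using inverse_of_injective[OF gram_carrier inj] by blast
  show "sp_form n (omega_b n b) \<inter> annihilator n ?v \<subseteq> sl_b n b"
  proof
    fix x assume "x \<in> sp_form n (omega_b n b) \<inter> annihilator n ?v"
    then have x: "x \<in> carrier_mat n n" and px: "preserves n x (omega_b n b)"
      and xv: "x *\<^sub>v ?v = 0\<^sub>v n"
      by (auto simp: sp_form_def annihilator_def)
    define A where "A = x * K"
    have A: "A \<in> carrier_mat n n" using x K by (simp add: A_def)
    have AJ: "A * ?J = x" using x K by (simp add: A_def assoc_mult_mat[of _ n n _ n _ n])
    have "(?J * A * ?J)\<^sup>T = ?J * A * ?J"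
      using preserves_gram_symmetric[OF x px] A x AJ by (simp add: assoc_mult_mat[of _ n n _ n _ n])
    \<comment> \<open>The signs from transposing the two skew factors cancel, so symmetry of J x = J
      A J becomes symmetry of \<open>A\<close> after J is cancelled on both sides.\<close>
    moreover have "(?J * A * ?J)\<^sup>T = ?J * A\<^sup>T * ?J"
    proof -
      have "(?J * A * ?J)\<^sup>T = ?J\<^sup>T * (A\<^sup>T * ?J\<^sup>T)"
        using A transpose_mult[of "?J * A" n n ?J n] transpose_mult[of ?J n n A n] by simp
      then show ?thesis
        using A by (simp add: transpose_gram assoc_mult_mat[of _ n n _ n _ n])
    qed
    ultimately have "K * (?J * A\<^sup>T * ?J) * K = K * (?J * A * ?J) * K" by simp
    moreover have "K * (?J * B * ?J) * K = B" if B: "B \<in> carrier_mat n n" for B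
    proof -
      have "K * (?J * B * ?J) * K = (K * ?J) * B * (?J * K)"
        using B K(1) by (simp add: assoc_mult_mat[of _ n n _ n _ n] mult_carrier_mat[of _ n n _ n])
      then show ?thesis using B K by simp
    qed
    ultimately have sym: "A\<^sup>T = A" using A by simp
    \<comment> \<open>\<open>w\<close> is a multiple of the last basis vector, and nonzero since J
      is injective. Hence x v^1 = A w = 0 says that the last column of \<open>A\<close>
      vanishes.\<close>
    define w where "w = ?J *\<^sub>v ?v"
    have w: "w \<in> carrier_vec n" by (simp add: w_def mult_mat_vec_carrier[of _ n n])
    have w0: "w $ i = 0" if "i < n - 1" for i
      using that by (simp add: w_def gram_mult_vec_functional u_functional_v_one
          del: index_mult_mat_vec)
    have "w $ (n - 1) \<noteq> 0"
    proof
      assume "w $ (n - 1) = 0"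
      then have "w $ i = 0" if "i < n" for i
        using w0 that by (cases "i = n - 1") auto
      then have "w = 0\<^sub>v n" using w by (intro eq_vecI) auto
      then show False using inj[of ?v] v_one_nonzero[of n b] n by (simp add: w_def)
    qed
    moreover have "A $$ (i, n - 1) * w $ (n - 1) = 0" if i: "i < n" for i
    proof -
      have "A *\<^sub>v w = 0\<^sub>v n"
        using A xv AJ by (simp add: w_def flip: assoc_mult_mat_vec[of _ n n _ n])
      then have "0 = (A *\<^sub>v w) $ i" using i by simp
      also have "\<dots> = (\<Sum>j<n. A $$ (i, j) * w $ j)"
        using A w i by (simp add: scalar_prod_def lessThan_atLeast0)
      also have "\<dots> = (\<Sum>j<n. if j = n - 1 then A $$ (i, n - 1) * w $ (n - 1) else 0)"
        using w0 by (intro sum.cong) auto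
      finally show ?thesis using n by (simp add: sum.delta)
    qed
    ultimately have "A * ?J \<in> sl_b n b"
      using symmetric_mult_gram_in_sl_b[OF nz A sym] by simp
    then show "x \<in> sl_b n b" by (simp add: AJ)
  qed
qed

subsection \<open>Isometries\<close>

text \<open>In \<omega>(Tx, Ty) the two terms linear in \<open>a\<close> cancel by skewness, and the
  quadratic one contains \<omega>(d, d) = 0.\<close>

lemma transvection_exists:
  assumes d: "d \<in> carrier_vec n"
  obtains T where "T \<in> carrier_mat n n"
    "\<And>x. x \<in> carrier_vec n \<Longrightarrow> T *\<^sub>v x = x + (a * omega_b n b d x) \<cdot>\<^sub>v d"
    "\<And>x y. x \<in> carrier_vec n \<Longrightarrow> y \<in> carrier_vec n \<Longrightarrow>
       omega_b n b (T *\<^sub>v x) (T *\<^sub>v y) = omega_b n b x y"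
proof
  let ?h = "\<lambda>j. omega_b n b d (unit_vec n j)"
  define T where "T = mat n n (\<lambda>(i, j). (if i = j then 1 else 0) + a * d $ i * ?h j)"
  show T: "T \<in> carrier_mat n n" by (simp add: T_def)
  show Tx: "T *\<^sub>v x = x + (a * omega_b n b d x) \<cdot>\<^sub>v d" if x: "x \<in> carrier_vec n" for x
  proof (rule eq_vecI)
    have lin: "omega_b n b d x = (\<Sum>j<n. ?h j * x $ j)"
    proof -
      have h: "?h j = - (gram n b *\<^sub>v d) $ j" if "j < n" for j
        using d that by (simp add: omega_b_swap[of n b d] omega_b_unit_left
            del: index_mult_mat_vec)
      have "omega_b n b d x = - (\<Sum>j<n. x $ j * (gram n b *\<^sub>v d) $ j)"
        using d x by (subst omega_b_swap)
          (simp add: omega_b_gram scalar_prod_def lessThan_atLeast0 del: index_mult_mat_vec)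
      also have "\<dots> = (\<Sum>j<n. ?h j * x $ j)"
        by (simp add: h mult.commute del: index_mult_mat_vec flip: sum_negf)
      finally show ?thesis .
    qed
    fix i assume "i < dim_vec (x + (a * omega_b n b d x) \<cdot>\<^sub>v d)"
    then have i: "i < n" using d by simp
    have "(T *\<^sub>v x) $ i = (\<Sum>j<n. ((if i = j then 1 else 0) + a * d $ i * ?h j) * x $ j)"
      using i x by (simp add: T_def scalar_prod_def lessThan_atLeast0)
    also have "\<dots> = (\<Sum>j<n. (if j = i then x $ i else 0) + a * d $ i * (?h j * x $ j))"
      by (intro sum.cong) (auto simp: algebra_simps)
    also have "\<dots> = x $ i + a * d $ i * omega_b n b d x"
      using i by (simp add: sum.distrib sum.delta lin sum_distrib_left)
    finally show "(T *\<^sub>v x) $ i = (x + (a * omega_b n b d x) \<cdot>\<^sub>v d) $ i"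
      using i d x by (simp add: algebra_simps)
  qed (use d in \<open>simp add: T_def\<close>)
  have dd: "omega_b n b d d = 0" using omega_b_swap[of n b d d] by simp
  show "omega_b n b (T *\<^sub>v x) (T *\<^sub>v y) = omega_b n b x y"
    if x: "x \<in> carrier_vec n" and y: "y \<in> carrier_vec n" for x y
    using d by (simp add: Tx[OF x] Tx[OF y] omega_b_add_left omega_b_add_right omega_b_smult_left
        omega_b_smult_right x y dd omega_b_swap[of n b x d])
qed

lemma isometry_transitive_nonorthogonal:
  assumes u: "u \<in> carrier_vec n" and w: "w \<in> carrier_vec n" and uw: "omega_b n b w u \<noteq> 0"
  shows "\<exists>T\<in>carrier_mat n n. T *\<^sub>v u = w \<and>
    (\<forall>x\<in>carrier_vec n. \<forall>y\<in>carrier_vec n. omega_b n b (T *\<^sub>v x) (T *\<^sub>v y) = omega_b n b x y)"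
proof -
  \<comment> \<open>Since \<omega>(d, u) = \<omega>(w, u), the transvection along \<open>d\<close>
    with parameter 1 / \<omega>(w, u) moves \<open>u\<close> by exactly \<open>d\<close>.\<close>
  define d where "d = w + (-1) \<cdot>\<^sub>v u"
  have d: "d \<in> carrier_vec n" using u w by (simp add: d_def)
  have "omega_b n b u u = 0" using omega_b_swap[of n b u u] by simp
  then have du: "omega_b n b d u = omega_b n b w u"
    using u w by (simp add: d_def omega_b_add_left omega_b_smult_left)
  obtain T where T: "T \<in> carrier_mat n n"
    "\<And>x. x \<in> carrier_vec n \<Longrightarrow> T *\<^sub>v x = x + (1 / omega_b n b w u * omega_b n b d x) \<cdot>\<^sub>v d"
    "\<And>x y. x \<in> carrier_vec n \<Longrightarrow> y \<in> carrier_vec n \<Longrightarrow>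
       omega_b n b (T *\<^sub>v x) (T *\<^sub>v y) = omega_b n b x y"
    using transvection_exists[OF d, of "1 / omega_b n b w u" b] by metis
  have "T *\<^sub>v u = u + 1 \<cdot>\<^sub>v d" using T(2)[OF u] du uw by simp
  then have "T *\<^sub>v u = w" using u w by (auto simp: d_def intro!: eq_vecI)
  with T show ?thesis by blast
qed

text \<open>A vector \<open>z\<close> orthogonal to neither \<open>u\<close> nor \<open>w\<close>
  serves as a stopover between two transvections.\<close>

lemma isometry_transitive:
  assumes nd: "nondegenerate n (omega_b n b)"
    and u: "u \<in> carrier_vec n" "u \<noteq> 0\<^sub>v n" and w: "w \<in> carrier_vec n" "w \<noteq> 0\<^sub>v n"
  shows "\<exists>T\<in>carrier_mat n n. T *\<^sub>v u = w \<and>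
    (\<forall>x\<in>carrier_vec n. \<forall>y\<in>carrier_vec n. omega_b n b (T *\<^sub>v x) (T *\<^sub>v y) = omega_b n b x y)"
proof -
  let ?w = "omega_b n b"
  have ex: "\<exists>z\<in>carrier_vec n. ?w z v \<noteq> 0" if "v \<in> carrier_vec n" "v \<noteq> 0\<^sub>v n" for v
    using nd that omega_b_swap[of n b v] by (auto simp: nondegenerate_def form_kernel_def)
  obtain z1 where z1: "z1 \<in> carrier_vec n" "?w z1 u \<noteq> 0" using ex u by blast
  obtain z2 where z2: "z2 \<in> carrier_vec n" "?w z2 w \<noteq> 0" using ex w by blast
  \<comment> \<open>If neither \<open>z1\<close> nor \<open>z2\<close> serves alone, then
    \<open>z1\<close> is orthogonal to \<open>w\<close> and \<open>z2\<close> to \<open>u\<close>,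
    so the mixed terms drop out for \<open>z1 + z2\<close>.\<close>
  have "\<exists>z\<in>carrier_vec n. ?w z u \<noteq> 0 \<and> ?w z w \<noteq> 0"
  proof (cases "?w z1 w = 0 \<and> ?w z2 u = 0")
    case True
    then show ?thesis using z1 z2 u w
      by (intro bexI[of _ "z1 + z2"]) (auto simp: omega_b_add_left)
  qed (use z1 z2 in blast)
  then obtain z where z: "z \<in> carrier_vec n" "?w z u \<noteq> 0" "?w w z \<noteq> 0"
    using omega_b_swap[of n b w] by auto
  obtain S where S: "S \<in> carrier_mat n n" "S *\<^sub>v u = z"
    "\<And>x y. x \<in> carrier_vec n \<Longrightarrow> y \<in> carrier_vec n \<Longrightarrow> ?w (S *\<^sub>v x) (S *\<^sub>v y) = ?w x y"
    using isometry_transitive_nonorthogonal[OF u(1) z(1,2)] by blast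
  obtain T where T: "T \<in> carrier_mat n n" "T *\<^sub>v z = w"
    "\<And>x y. x \<in> carrier_vec n \<Longrightarrow> y \<in> carrier_vec n \<Longrightarrow> ?w (T *\<^sub>v x) (T *\<^sub>v y) = ?w x y"
    using isometry_transitive_nonorthogonal[OF z(1) w(1) z(3)] by blast
  have TS: "(T * S) *\<^sub>v x = T *\<^sub>v (S *\<^sub>v x)" "S *\<^sub>v x \<in> carrier_vec n" if "x \<in> carrier_vec n" for x
    using that S T by (auto simp: assoc_mult_mat_vec[of _ n n _ n] mult_mat_vec_carrier[of _ n n])
  show ?thesis
    using S T u TS by (intro bexI[of _ "T * S"]) auto
qed

section \<open>Conjugation by a linear isomorphism\<close>

text \<open>The trace survives by cyclicity, and invariance of \<open>\<beta>\<close> at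
  \<open>y\<close>, \<open>z\<close> is invariance of \<open>\<alpha>\<close> at \<open>Q y\<close>,
  \<open>Q z\<close>.\<close>

lemma conjugate_in_sp_annihilator:
  assumes P: "P \<in> carrier_mat n n" and Q: "Q \<in> carrier_mat n n"
    and PQ: "P * Q = 1\<^sub>m n" and QP: "Q * P = 1\<^sub>m n"
    and iso: "\<And>v w. v \<in> carrier_vec n \<Longrightarrow> w \<in> carrier_vec n \<Longrightarrow> \<alpha> v w = \<beta> (P *\<^sub>v v) (P *\<^sub>v w)"
    and v: "v \<in> carrier_vec n"
    and x: "x \<in> sp_form n \<alpha> \<inter> annihilator n v"
  shows "P * x * Q \<in> sp_form n \<beta> \<inter> annihilator n (P *\<^sub>v v)"
proof -
  have xc: "x \<in> carrier_mat n n" and px: "preserves n x \<alpha>" and xv: "x *\<^sub>v v = 0\<^sub>v n"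
    and xt: "mat_trace x = 0"
    using x by (auto simp: sp_form_def annihilator_def sl_def)
  have "mat_trace (P * x * Q) = mat_trace (Q * (P * x))"
    using P Q xc by (intro mat_trace_comm) auto
  also have "Q * (P * x) = x"
    using P Q xc QP by (simp flip: assoc_mult_mat[of _ n n _ n _ n])
  finally have tr: "P * x * Q \<in> sl n"
    using P Q xc xt by (simp add: sl_def)
  have act: "(P * x * Q) *\<^sub>v y = P *\<^sub>v (x *\<^sub>v (Q *\<^sub>v y))" if "y \<in> carrier_vec n" for y
    using P Q xc that by (simp add: assoc_mult_mat_vec[of _ n n _ n] mult_mat_vec_carrier[of _ n n])
  have cancel: "P *\<^sub>v (Q *\<^sub>v y) = y" "Q *\<^sub>v (P *\<^sub>v y) = y" if "y \<in> carrier_vec n" for y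
    using P Q PQ QP that by (simp_all flip: assoc_mult_mat_vec[of _ n n _ n])
  have "preserves n (P * x * Q) \<beta>"
    unfolding preserves_def
  proof (intro ballI)
    fix y z :: "complex vec" assume y: "y \<in> carrier_vec n" and z: "z \<in> carrier_vec n"
    let ?y = "Q *\<^sub>v y" and ?z = "Q *\<^sub>v z"
    have c: "?y \<in> carrier_vec n" "?z \<in> carrier_vec n" "x *\<^sub>v ?y \<in> carrier_vec n"
      "x *\<^sub>v ?z \<in> carrier_vec n"
      using Q xc y z by (auto simp: mult_mat_vec_carrier[of _ n n])
    have "\<alpha> (x *\<^sub>v ?y) ?z + \<alpha> ?y (x *\<^sub>v ?z) = 0"
      using px c by (simp add: preserves_def)
    then show "\<beta> ((P * x * Q) *\<^sub>v y) z + \<beta> y ((P * x * Q) *\<^sub>v z) = 0"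
      using c y z by (simp add: act iso cancel)
  qed
  moreover have "(P * x * Q) *\<^sub>v (P *\<^sub>v v) = 0\<^sub>v n"
  proof -
    have "P *\<^sub>v 0\<^sub>v n = 0\<^sub>v n" using P by (intro eq_vecI) auto
    then show ?thesis using P v xv by (simp add: act cancel mult_mat_vec_carrier[of _ n n])
  qed
  ultimately show ?thesis
    using tr P Q xc by (simp add: sp_form_def annihilator_def)
qed

lemma lie_isomorphic_sp_annihilator:
  assumes P: "P \<in> carrier_mat n n" and Q: "Q \<in> carrier_mat n n"
    and PQ: "P * Q = 1\<^sub>m n" and QP: "Q * P = 1\<^sub>m n"
    and iso: "\<And>v w. v \<in> carrier_vec n \<Longrightarrow> w \<in> carrier_vec n \<Longrightarrow> \<alpha> v w = \<beta> (P *\<^sub>v v) (P *\<^sub>v w)"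
    and v: "v \<in> carrier_vec n"
  shows "lie_isomorphic (sp_form n \<alpha> \<inter> annihilator n v) (sp_form n \<beta> \<inter> annihilator n (P *\<^sub>v v))"
  (is "lie_isomorphic ?L ?M")
proof -
  have Lc: "x \<in> carrier_mat n n" if "x \<in> ?L" for x using that by (simp add: annihilator_def)
  have Mc: "x \<in> carrier_mat n n" if "x \<in> ?M" for x using that by (simp add: annihilator_def)
  note assoc = assoc_mult_mat[of _ n n _ n _ n]
  have cancel1: "P * (Q * x) = x" "Q * (P * x) = x" if "x \<in> carrier_mat n n" for x
    using that P Q PQ QP by (simp_all flip: assoc)
  have cancel: "P *\<^sub>v (Q *\<^sub>v y) = y" "Q *\<^sub>v (P *\<^sub>v y) = y" if "y \<in> carrier_vec n" for y
    using P Q PQ QP that by (simp_all flip: assoc_mult_mat_vec[of _ n n _ n])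
  \<comment> \<open>This lets the conjugation lemma be applied with \<open>P\<close> and
    \<open>Q\<close> exchanged, which supplies the inverse map.\<close>
  have iso': "\<beta> y z = \<alpha> (Q *\<^sub>v y) (Q *\<^sub>v z)" if "y \<in> carrier_vec n" "z \<in> carrier_vec n" for y z
    using that Q by (simp add: iso cancel mult_mat_vec_carrier[of _ n n])
  have maps: "P * x * Q \<in> ?M" if "x \<in> ?L" for x
    by (rule conjugate_in_sp_annihilator[OF P Q PQ QP iso v that])
  have maps': "Q * x * P \<in> ?L" if "x \<in> ?M" for x
    using conjugate_in_sp_annihilator[OF Q P QP PQ iso' _ that] P v
    by (simp add: cancel mult_mat_vec_carrier[of _ n n])
  have inv: "Q * (P * x * Q) * P = x" "P * (Q * x * P) * Q = x" if "x \<in> carrier_mat n n" for x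
    using that P Q PQ QP by (simp_all add: assoc cancel1 mult_carrier_mat[of _ n n _ n])
  let ?\<phi> = "\<lambda>x. P * x * Q"
  have "bij_betw ?\<phi> ?L ?M"
    using maps maps' inv Lc Mc by (intro bij_betw_byWitness[of _ "\<lambda>x. Q * x * P"]) auto
  moreover have "?\<phi> (x + y) = ?\<phi> x + ?\<phi> y" if "x \<in> ?L" "y \<in> ?L" for x y
    using Lc[OF that(1)] Lc[OF that(2)] P Q
    by (simp add: mult_add_distrib_mat[of _ n n _ n] add_mult_distrib_mat[of _ n n _ _ n])
  moreover have "?\<phi> (c \<cdot>\<^sub>m x) = c \<cdot>\<^sub>m ?\<phi> x" if "x \<in> ?L" for x c
    using Lc[OF that] P Q
    by (simp add: mult_smult_distrib[of _ n n _ n] mult_smult_assoc_mat[of _ n n _ n])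
  moreover have "?\<phi> (lie_bracket x y) = lie_bracket (?\<phi> x) (?\<phi> y)" if "x \<in> ?L" "y \<in> ?L" for x y
  proof -
    have c: "x \<in> carrier_mat n n" "y \<in> carrier_mat n n" using that Lc by auto
    have prod: "?\<phi> (x * y) = ?\<phi> x * ?\<phi> y" if "x \<in> carrier_mat n n" "y \<in> carrier_mat n n" for x y
      using that P Q by (simp add: assoc cancel1 mult_carrier_mat[of _ n n _ n])
    have "?\<phi> (x * y - y * x) = ?\<phi> (x * y) - ?\<phi> (y * x)"
      using c P Q
      by (simp add: mult_minus_distrib_mat[of _ n n _ n] minus_mult_distrib_mat[of _ n n _ _ n]
          mult_carrier_mat[of _ n n _ n])
    then show ?thesis using c by (simp add: lie_bracket_def prod)
  qed
  ultimately show ?thesis unfolding lie_isomorphic_def by blast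
qed

section \<open>Darboux coordinates and the odd symplectic algebra\<close>

text \<open>With coordinates counted from 0, the upper rows are p_r = c_{2r+1} v_{2r} - c_{2r+2}
  v_{2r+2} and the lower rows q_r = v_{2r+1}. For even \<open>n\<close> and the last p_r, column
  \<open>2 * r + 2\<close> is \<open>n\<close>, which is out of range.\<close>

definition darboux_mat :: "nat \<Rightarrow> (nat \<Rightarrow> complex) \<Rightarrow> complex mat" where
  "darboux_mat n b = mat n n (\<lambda>(r, c).
     if r < n div 2 then
       if c = 2 * r then omega_coeff n b (2 * r + 1)
       else if c = 2 * r + 2 then - omega_coeff n b (2 * r + 2) else 0
     else if c = 2 * (r - n div 2) + 1 then 1 else 0)"

lemma darboux_mat_carrier [simp]: "darboux_mat n b \<in> carrier_mat n n"
  by (simp add: darboux_mat_def)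

lemma std_symplectic_sum:
  "std_symplectic n v w =
     (\<Sum>k<n div 2. v $ k * w $ (n div 2 + k) - w $ k * v $ (n div 2 + k))"
proof -
  have "std_symplectic n v w = (\<Sum>k\<in>Suc ` {..<n div 2}.
      wedge (dual_basis k) (dual_basis (n div 2 + k)) v w)"
    unfolding std_symplectic_def by (rule sum.cong) (auto simp: image_Suc_lessThan)
  then show ?thesis
    by (simp add: sum.reindex wedge_def dual_basis_def)
qed

lemma sum_lessThan_double:
  fixes g :: "nat \<Rightarrow> 'a::comm_monoid_add"
  shows "(\<Sum>k<2 * m. g k) = (\<Sum>r<m. g (2 * r) + g (2 * r + 1))"
  by (induction m) (simp_all add: add.assoc)

text \<open>Collecting the terms of \<open>\<omega>\<^sub>b\<close> that contain \<open>v\<^bsub>2k\<^esub>\<^sup>*\<close> gives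
  \<open>\<omega>\<^sub>b = \<Sum>\<^sub>k (c\<^bsub>2k-1\<^esub> v\<^bsub>2k-1\<^esub>\<^sup>* - c\<^bsub>2k\<^esub> v\<^bsub>2k+1\<^esub>\<^sup>*) \<and> v\<^bsub>2k\<^esub>\<^sup>*\<close>.\<close>

lemma omega_b_std_symplectic:
  assumes n: "even n" and v: "v \<in> carrier_vec n" and w: "w \<in> carrier_vec n"
  shows "omega_b n b v w = std_symplectic n (darboux_mat n b *\<^sub>v v) (darboux_mat n b *\<^sub>v w)"
proof -
  obtain m where m: "n = 2 * m" using n by (auto elim: evenE)
  let ?c = "omega_coeff n b" and ?D = "darboux_mat n b"
  let ?t = "\<lambda>k. v $ k * w $ Suc k - w $ k * v $ Suc k"
  have lo: "(?D *\<^sub>v y) $ r = ?c (2 * r + 1) * y $ (2 * r) -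
      (if 2 * r + 2 < n then ?c (2 * r + 2) * y $ (2 * r + 2) else 0)"
    if "y \<in> carrier_vec n" "r < m" for y r
  proof -
    have "(?D *\<^sub>v y) $ r = (\<Sum>j<n. (if j = 2 * r then ?c (2 * r + 1) * y $ j else 0) -
        (if j = 2 * r + 2 then ?c (2 * r + 2) * y $ j else 0))"
      using that m
      by (auto simp: darboux_mat_def scalar_prod_def lessThan_atLeast0 intro!: sum.cong)
    then show ?thesis using that m by (simp add: sum_subtractf sum.delta)
  qed
  have hi: "(?D *\<^sub>v y) $ (m + r) = y $ (2 * r + 1)" if "y \<in> carrier_vec n" "r < m" for y r
  proof -
    have "(?D *\<^sub>v y) $ (m + r) = (\<Sum>j<n. if j = 2 * r + 1 then y $ j else 0)"
    proof -
      have "(?D *\<^sub>v y) $ (m + r) = (\<Sum>j<n. (if j = 2 * r + 1 then 1 else 0) * y $ j)"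
        using that m by (simp add: darboux_mat_def scalar_prod_def lessThan_atLeast0)
      also have "\<dots> = (\<Sum>j<n. if j = 2 * r + 1 then y $ j else 0)"
        by (intro sum.cong) auto
      finally show ?thesis .
    qed
    then show ?thesis using that m by (simp add: sum.delta)
  qed
  \<comment> \<open>A zero summand is appended, so that the number of summands is even and they can
    be grouped in pairs.\<close>
  have "omega_b n b v w = (\<Sum>k<n. if Suc k < n then ?c (Suc k) * ?t k else 0)"
    unfolding omega_b_sum by (rule sum.mono_neutral_cong_left) auto
  also have "\<dots> = (\<Sum>r<m. ?c (2 * r + 1) * ?t (2 * r) +
      (if 2 * r + 2 < n then ?c (2 * r + 2) * ?t (2 * r + 1) else 0))"
    unfolding m sum_lessThan_double by (rule sum.cong) auto
  also have "\<dots> = (\<Sum>r<m. (?D *\<^sub>v v) $ r * (?D *\<^sub>v w) $ (m + r) - (?D *\<^sub>v w) $ r * (?D *\<^sub>v v) $ (m + r))"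
  proof (rule sum.cong)
    fix r assume "r \<in> {..<m}"
    then have r: "r < m" by simp
    show "?c (2 * r + 1) * ?t (2 * r) +
      (if 2 * r + 2 < n then ?c (2 * r + 2) * ?t (2 * r + 1) else 0) =
      (?D *\<^sub>v v) $ r * (?D *\<^sub>v w) $ (m + r) - (?D *\<^sub>v w) $ r * (?D *\<^sub>v v) $ (m + r)"
      unfolding lo[OF v r] lo[OF w r] hi[OF v r] hi[OF w r] by (simp add: algebra_simps)
  qed simp
  also have "\<dots> = std_symplectic n (?D *\<^sub>v v) (?D *\<^sub>v w)"
    by (simp add: std_symplectic_sum m)
  finally show ?thesis .
qed

text \<open>A vector killed by \<open>P\<close> is orthogonal to everything, hence zero; a square
  injective matrix is invertible.\<close>

lemma isometry_invertible:
  assumes nd: "nondegenerate n (omega_b n b)" and P: "P \<in> carrier_mat n n"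
    and iso: "\<And>v w. v \<in> carrier_vec n \<Longrightarrow> w \<in> carrier_vec n \<Longrightarrow>
      omega_b n b v w = std_symplectic n (P *\<^sub>v v) (P *\<^sub>v w)"
  shows "\<exists>Q\<in>carrier_mat n n. P * Q = 1\<^sub>m n \<and> Q * P = 1\<^sub>m n"
proof -
  have "v = 0\<^sub>v n" if v: "v \<in> carrier_vec n" "P *\<^sub>v v = 0\<^sub>v n" for v
  proof -
    have "omega_b n b v y = 0" if y: "y \<in> carrier_vec n" for y
      using iso[OF v(1) y] v P y by (auto simp: std_symplectic_sum intro!: sum.neutral)
    then show ?thesis using nd v by (auto simp: nondegenerate_def form_kernel_def)
  qed
  then show ?thesis using inverse_of_injective[OF P] by metis
qed

lemma sl_b_isomorphic_odd_sp:
  assumes n: "n \<ge> 2" "even n" and nd: "nondegenerate n (omega_b n b)"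
    and w: "w \<in> carrier_vec n" "w \<noteq> 0\<^sub>v n"
  shows "lie_isomorphic (sl_b n b) (odd_sp n w)"
proof -
  let ?D = "darboux_mat n b"
  obtain E where E: "E \<in> carrier_mat n n" "?D * E = 1\<^sub>m n"
    using isometry_invertible[OF nd darboux_mat_carrier omega_b_std_symplectic[OF n(2)]] by blast
  \<comment> \<open>\<open>y\<close> is the preimage of \<open>w\<close> under \<open>?D\<close>. An
    isometry \<open>T\<close> of \<omega>_b taking v^1 to \<open>y\<close> then makes
    \<open>?D * T\<close> carry \<omega>_b to the standard form and v^1 to \<open>w\<close>.\<close>
  define y where "y = E *\<^sub>v w"
  have y: "y \<in> carrier_vec n" using E w by (simp add: y_def mult_mat_vec_carrier[of _ n n])
  have Dy: "?D *\<^sub>v y = w"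
    using E w by (simp add: y_def flip: assoc_mult_mat_vec[of _ n n _ n])
  have "?D *\<^sub>v 0\<^sub>v n = 0\<^sub>v n"
    by (intro eq_vecI) (auto simp: darboux_mat_def)
  then have "y \<noteq> 0\<^sub>v n" using Dy w by auto
  then obtain T where T: "T \<in> carrier_mat n n" "T *\<^sub>v v_one n b = y"
    "\<And>x z. x \<in> carrier_vec n \<Longrightarrow> z \<in> carrier_vec n \<Longrightarrow>
      omega_b n b (T *\<^sub>v x) (T *\<^sub>v z) = omega_b n b x z"
    using isometry_transitive[OF nd v_one_carrier v_one_nonzero[of n b] y] n by fastforce
  define P where "P = ?D * T"
  have P: "P \<in> carrier_mat n n" using T by (simp add: P_def mult_carrier_mat[of _ n n])
  have Px: "P *\<^sub>v x = ?D *\<^sub>v (T *\<^sub>v x)" if "x \<in> carrier_vec n" for x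
    using that T by (simp add: P_def assoc_mult_mat_vec[of _ n n _ n])
  have iso: "omega_b n b x z = std_symplectic n (P *\<^sub>v x) (P *\<^sub>v z)"
    if "x \<in> carrier_vec n" "z \<in> carrier_vec n" for x z
    using that T omega_b_std_symplectic[OF n(2), of "T *\<^sub>v x" "T *\<^sub>v z" b]
    by (simp add: Px mult_mat_vec_carrier[of _ n n])
  obtain Q where Q: "Q \<in> carrier_mat n n" "P * Q = 1\<^sub>m n" "Q * P = 1\<^sub>m n"
    using isometry_invertible[OF nd P iso] by blast
  have "lie_isomorphic (sp_form n (omega_b n b) \<inter> annihilator n (v_one n b))
      (sp_form n (std_symplectic n) \<inter> annihilator n (P *\<^sub>v v_one n b))"
    by (rule lie_isomorphic_sp_annihilator[OF P Q]) (use iso in auto)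
  then show ?thesis
    by (simp add: sl_b_eq[OF n(1) nd] odd_sp_def Px T Dy)
qed

subsection \<open>The odd case\<close>

text \<open>With coordinates counted from 0, the last row gives v_{n-2} = 0, which propagates down
  the odd coordinates; the rows of odd index impose the recursion of v^1 on the even ones. Only c_k
  with \<open>k > 1\<close> get cancelled, so b_1 may be zero.\<close>

lemma form_kernel_odd:
  assumes n: "n \<ge> 2" "odd n" and nz: "\<And>k. 1 < k \<Longrightarrow> k < n \<Longrightarrow> omega_coeff n b k \<noteq> 0"
  shows "form_kernel n (omega_b n b) = {a \<cdot>\<^sub>v v_one n b | a. True}"
proof
  let ?v = "v_one n b"
  show "{a \<cdot>\<^sub>v ?v | a. True} \<subseteq> form_kernel n (omega_b n b)"
  proof clarify
    fix a
    have "gram n b *\<^sub>v (a \<cdot>\<^sub>v ?v) = 0\<^sub>v n"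
    proof (rule eq_vecI)
      fix i assume "i < dim_vec (0\<^sub>v n :: complex vec)"
      then have i: "i < n" by simp
      have "(gram n b *\<^sub>v ?v) $ i = 0"
      proof (cases "i < n - 1")
        case True
        then show ?thesis
          by (simp add: gram_mult_vec_functional u_functional_v_one del: index_mult_mat_vec)
      next
        case False
        \<comment> \<open>The last row is tied to no generator. It involves only coordinate
          \<open>n - 2\<close>, which is odd here, and v^1 vanishes there.\<close>
        then have "i = n - 1" using i by simp
        then have "\<not> Suc i < n" "odd (i - 1)" using n by auto
        then show ?thesis using i
          by (simp add: gram_mult_vec v_one_index del: index_mult_mat_vec)
      qed
      then show "(gram n b *\<^sub>v (a \<cdot>\<^sub>v ?v)) $ i = 0\<^sub>v n $ i"
        using i by (simp add: mult_mat_vec[of _ n n] del: index_mult_mat_vec)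
    qed simp
    then show "a \<cdot>\<^sub>v ?v \<in> form_kernel n (omega_b n b)" by (simp add: form_kernel_omega_b)
  qed
  show "form_kernel n (omega_b n b) \<subseteq> {a \<cdot>\<^sub>v ?v | a. True}"
  proof
    fix v assume "v \<in> form_kernel n (omega_b n b)"
    then have v: "v \<in> carrier_vec n" and ker: "gram n b *\<^sub>v v = 0\<^sub>v n"
      by (auto simp: form_kernel_omega_b)
    have eq: "(if Suc r < n then omega_coeff n b (Suc r) * v $ Suc r else 0) =
        (if r = 0 then 0 else omega_coeff n b r * v $ (r - 1))" if "r < n" for r
      using gram_mult_vec[OF v that, of b] ker that by simp
    have odd_zero: "v $ (n - 2 * k - 2) = 0" if "2 * k + 2 < n" for k
      using that
    proof (induction k)
      case 0
      then show ?case using eq[of "n - 1"] nz[of "n - 1"] n by (auto simp: numeral_2_eq_2)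
    next
      case (Suc k)
      let ?r = "n - 2 * k - 3"
      have "Suc ?r = n - 2 * k - 2" "?r - 1 = n - 2 * Suc k - 2" using Suc.prems by auto
      then show ?case using eq[of ?r] nz[of ?r] Suc by auto
    qed
    have even_eq: "v $ (2 * k) = v $ 0 * ?v $ (2 * k)" if "2 * k < n" for k
      using that
    proof (induction k)
      case 0
      then show ?case by (simp add: v_one_index)
    next
      case (Suc k)
      have c: "omega_coeff n b (2 * k + 2) \<noteq> 0" using nz[of "2 * k + 2"] Suc.prems by simp
      \<comment> \<open>The right-hand side is c_{2k+1} v_{2k} rewritten by the recursion, so that
        c_{2k+2} can be cancelled instead of c_{2k+1}.\<close>
      have "omega_coeff n b (2 * k + 2) * v $ (2 * k + 2) =
          omega_coeff n b (2 * k + 2) * (- b (2 * k + 1) * v $ (2 * k))"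
        using eq[of "2 * k + 1"] omega_coeff_step[of "2 * k + 1" n b] Suc.prems by simp
      then have "v $ (2 * k + 2) = - b (2 * k + 1) * v $ (2 * k)"
        using c mult_left_cancel by blast
      then show ?case using Suc v_one_Suc_Suc[of "2 * k" n b] by simp
    qed
    have "v = v $ 0 \<cdot>\<^sub>v ?v"
    proof (rule eq_vecI)
      fix i assume "i < dim_vec (v $ 0 \<cdot>\<^sub>v ?v)"
      then have i: "i < n" by simp
      show "v $ i = (v $ 0 \<cdot>\<^sub>v ?v) $ i"
      proof (cases "even i")
        case True
        then obtain k where "i = 2 * k" by (auto elim: evenE)
        then show ?thesis
          using even_eq[of k] i by simp
      next
        case False
        with n obtain k m where km: "i = 2 * k + 1" "n = 2 * m + 1" by (auto elim!: oddE)
        then have "n - 2 * (m - k - 1) - 2 = i" "2 * (m - k - 1) + 2 < n" using i by auto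
        then have "v $ i = 0" using odd_zero[of "m - k - 1"] by simp
        then show ?thesis
          using i False by (simp add: v_one_index)
      qed
    qed (use v in simp)
    then show "v \<in> {a \<cdot>\<^sub>v ?v | a. True}" by blast
  qed
qed

section \<open>Dimension of the kernel line\<close>

lemma subspace_dim_line:
  assumes v: "v \<in> carrier_vec n" "v \<noteq> 0\<^sub>v n"
  shows "subspace_dim n {a \<cdot>\<^sub>v v | a. True} = 1"
proof -
  interpret vec_space "TYPE(complex)" n .
  have lc: "lincomb a {v} = a v \<cdot>\<^sub>v v" for a
    using v by (auto simp: lincomb_def)
  have indpt: "lin_indpt {v}"
  proof (rule finite_lin_indpt2)
    fix a assume "lincomb a {v} = 0\<^sub>v n"
    then have "a v \<cdot>\<^sub>v v = 0\<^sub>v n" by (simp add: lc)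
    moreover obtain i where "i < n" "v $ i \<noteq> 0" using v by (metis eq_vecI carrier_vecD index_zero_vec)
    ultimately have "a v = 0" using v(1) by (metis carrier_vecD index_smult_vec(1) index_zero_vec(1) mult_eq_0_iff)
    then show "\<forall>u\<in>{v}. a u = 0" by simp
  qed (use v in auto)
  have "span {v} = {a \<cdot>\<^sub>v v | a. True}"
    using v by (subst finite_span) (auto simp: lc)
  moreover have "vectorspace.dim class_ring (vs (span {v})) = card {v}"
    using v indpt by (intro dim_span) (auto simp: maximal_def)
  ultimately show ?thesis by simp
qed

theorem theorem1p7:
  fixes n :: nat and b :: "nat \<Rightarrow> complex"
  assumes "n \<ge> 2"
  shows
    "(\<forall>x\<in>sl_b n b. preserves n x (omega_b n b)) \<and>
     (even n \<longrightarrow>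
        ((\<Prod>i = 1..n - 2. b i) \<noteq> 0 \<longrightarrow> nondegenerate n (omega_b n b)) \<and>
        (nondegenerate n (omega_b n b) \<longrightarrow>
           sl_b n b = sp_form n (omega_b n b) \<inter> annihilator n (v_one n b)) \<and>
        ((\<Prod>i = 1..n - 2. b i) \<noteq> 0 \<longrightarrow>
           (\<forall>w\<in>carrier_vec n. w \<noteq> 0\<^sub>v n \<longrightarrow> lie_isomorphic (sl_b n b) (odd_sp n w)))) \<and>
     (odd n \<longrightarrow> (\<Prod>i = 2..n - 2. b i) \<noteq> 0 \<longrightarrow>
        subspace_dim n (form_kernel n (omega_b n b)) = 1 \<and>
        (\<forall>x\<in>sl_b n b. \<forall>z\<in>form_kernel n (omega_b n b). x *\<^sub>v z = 0\<^sub>v n))"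
proof -
  have pres: "\<forall>x\<in>sl_b n b. preserves n x (omega_b n b)"
    using sl_b_subset_sp by (auto simp: sp_form_def)
  have nondeg: "nondegenerate n (omega_b n b)" if "even n" "(\<Prod>i = 1..n - 2. b i) \<noteq> 0"
    using assms that(1) omega_coeff_nonzero[OF that(2)] by (intro nondegenerate_omega_b) auto
  have kernel: "form_kernel n (omega_b n b) = {a \<cdot>\<^sub>v v_one n b | a. True}"
    if "odd n" "(\<Prod>i = 2..n - 2. b i) \<noteq> 0"
    using assms that(1) omega_coeff_nonzero[OF that(2)] by (intro form_kernel_odd) auto
  \<comment> \<open>For odd \<open>n\<close> the kernel is spanned by v^1, so its invariance takes
    the strong form that the algebra acts on it by zero.\<close>
  have "x *\<^sub>v (a \<cdot>\<^sub>v v_one n b) = 0\<^sub>v n" if "x \<in> sl_b n b" for x a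
  proof -
    have "x \<in> carrier_mat n n" "x *\<^sub>v v_one n b = 0\<^sub>v n"
      using that sl_b_v_one[of n b] by (auto simp: annihilator_def)
    then show ?thesis by (auto simp: mult_mat_vec[of _ n n] intro!: eq_vecI)
  qed
  then show ?thesis
    using pres nondeg kernel sl_b_eq[OF assms] sl_b_isomorphic_odd_sp[OF assms]
      subspace_dim_line[OF v_one_carrier v_one_nonzero, of n b] assms
    by auto
qed

end
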